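(* Let $H$ be a monoid. Then the following statements are equivalent: (a) $(H:_l\mathfrak c)=(H:_r\mathfrak c)$ for all fractional ideals $\mathfrak c$ of $H$, $aH\in\mathcal I_v^*(H)$ for all $a\in H$, and the map $\partial\colon H\to\mathcal I_v^*(H)$ defined by $\partial(a)=aH$ for all $a\in H$ is a divisor theory (where $\mathcal I_v^*(H)$ carries $v$-multiplication). (b) $H$ has a divisor theory. (c) There exists a divisor homomorphism $\varphi\colon H\to\mathcal F(P)$ into a free abelian monoid $\mathcal F(P)$ with some basis $P$. (d) $H$ is a normalizing Krull monoid.
   Context: A monoid is a cancellative semigroup with unit element satisfying the left and right Ore conditions ($Ha\cap Hb\ne\emptyset$ and $aH\cap bH\neq\emptyset$ for all $a,b\in H$); $\mathsf q(H)$ is its quotient group, in which every element has the form $a^{-1}b$ and also the form $ba^{-1}$ with $a,b\in H$. Homomorphisms preserve $1$. For $A,B\subset\mathsf q(H)$: $AB=\{ab\mid a\in A,b\in B\}$, $(A:_lB)=\{x\in\mathsf q(H)\mid xB\subset A\}$, $(A:_rB)=\{x\in\mathsf q(H)\mid Bx\subset A\}$. A fractional ideal of $H$ is a subset $\mathfrak a\subset\mathsf q(H)$ with $H\mathfrak a=\mathfrak a=\mathfrak aH$ such that $a\mathfrak a\subset H$ and $\mathfrak ab\subset H$ for some $a,b\in H$; it is an ideal if moreover $\mathfrak a\subset H$ (the empty set is an ideal). If $\bigl(H:_l(H:_r\mathfrak a)\bigr)=\bigl(H:_r(H:_l\mathfrak a)\bigr)$, this set is denoted $\mathfrak a_v$;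 a (fractional) ideal with $\mathfrak a_v=\mathfrak a$ is called a divisorial (fractional) ideal, or (fractional) $v$-ideal. $\mathcal I_v(H)$ is the set of divisorial ideals contained in $H$. If $(H:_l\mathfrak c)=(H:_r\mathfrak c)$ for all fractional ideals $\mathfrak c$, put $\mathfrak a^{-1}=(H:_l\mathfrak a)$ and $\mathfrak a\cdot_v\mathfrak b=(\mathfrak a\mathfrak b)_v$ ($v$-multiplication); $\mathfrak a$ is $v$-invertible if $\mathfrak a\cdot_v\mathfrak a^{-1}=\mathfrak a^{-1}\cdot_v\mathfrak a=H$, and $\mathcal I_v^*(H)$ is the set of $v$-invertible elements of $\mathcal I_v(H)$. $H$ is normalizing if $aH=Ha$ for all $a\in H$. $H$ is completely integrally closed if $(\mathfrak a:_l\mathfrak a)=(\mathfrak a:_r\mathfrak a)=H$ for all non-empty ideals $\mathfrak a$ of $H$; $v$-noetherian if it satisfies the ascending chain condition on $v$-ideals of $H$ (elements of $\mathcal I_v(H)$); a Krull monoid if it is both. Write $a\mid_l b$ if $b\in aH$ and $a\mid_r b$ if $b\in Ha$. A monoid homomorphism $\varphi\colon H\to D$ is a divisor homomorphism if for all $u,v\in H$, $\varphi(u)\mid_l\varphi(v)$ implies $u\mid_l v$ and $\varphi(u)\mid_r\varphi(v)$ implies $u\mid_r v$. $\mathcal F(P)$ denotes the free abelian monoid with basis $P$. A divisor theory for $H$ is a divisor homomorphism $\varphi\colon H\to D$ such that $D$ is free abelian, $D=\mathcal F(P)$ for some set $P$, and for every $p\in P$ there is a finite non-empty $X\subset H$ with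 $p=\gcd(\varphi(X))$. *)

theory Defs
  imports "HOL-Algebra.Coset" "HOL-Algebra.FiniteProduct" "HOL-Algebra.Divisibility"
begin

section \<open>Monoids and their quotient groups\<close>

locale ore_monoid = monoid_cancel H for H (structure) +
  assumes left_ore:
      "\<lbrakk>a \<in> carrier H; b \<in> carrier H\<rbrakk> \<Longrightarrow> (carrier H #> a) \<inter> (carrier H #> b) \<noteq> {}"
    and right_ore:
      "\<lbrakk>a \<in> carrier H; b \<in> carrier H\<rbrakk> \<Longrightarrow> (a <# carrier H) \<inter> (b <# carrier H) \<noteq> {}"

text \<open>The pair \<open>(a, b)\<close> stands for the left fraction \<open>a\<^sup>-\<^sup>1 b\<close>; an element of the quotient group is
  the set of all pairs representing it.\<close>

definition frac_rel :: "('a, 'm) monoid_scheme \<Rightarrow> (('a \<times> 'a) \<times> ('a \<times> 'a)) set" where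
  "frac_rel H = {((a, b), (c, d)). a \<in> carrier H \<and> b \<in> carrier H \<and> c \<in> carrier H \<and> d \<in> carrier H \<and>
     (\<exists>u\<in>carrier H. \<exists>v\<in>carrier H. u \<otimes>\<^bsub>H\<^esub> a = v \<otimes>\<^bsub>H\<^esub> c \<and> u \<otimes>\<^bsub>H\<^esub> b = v \<otimes>\<^bsub>H\<^esub> d)}"

definition frac :: "('a, 'm) monoid_scheme \<Rightarrow> 'a \<Rightarrow> 'a \<Rightarrow> ('a \<times> 'a) set" where
  "frac H a b = frac_rel H `` {(a, b)}"

text \<open>If \<open>u b = v c\<close> then \<open>b c\<^sup>-\<^sup>1 = u\<^sup>-\<^sup>1 v\<close>, so \<open>a\<^sup>-\<^sup>1 b \<cdot> c\<^sup>-\<^sup>1 d = (u a)\<^sup>-\<^sup>1 (v d)\<close>. The result does not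
  depend on any choice (\<open>frac_mult_frac\<close> below), so the union is over copies of one class.\<close>

definition frac_mult ::
  "('a, 'm) monoid_scheme \<Rightarrow> ('a \<times> 'a) set \<Rightarrow> ('a \<times> 'a) set \<Rightarrow> ('a \<times> 'a) set" where
  "frac_mult H X Y = \<Union> {frac H (u \<otimes>\<^bsub>H\<^esub> a) (v \<otimes>\<^bsub>H\<^esub> d) | a b c d u v.
     (a, b) \<in> X \<and> (c, d) \<in> Y \<and> u \<in> carrier H \<and> v \<in> carrier H \<and> u \<otimes>\<^bsub>H\<^esub> b = v \<otimes>\<^bsub>H\<^esub> c}"

definition quot_group :: "('a, 'm) monoid_scheme \<Rightarrow> ('a \<times> 'a) set monoid" where
  "quot_group H = \<lparr>carrier = (carrier H \<times> carrier H) // frac_rel H, monoid.mult = frac_mult H,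
     one = frac H \<one>\<^bsub>H\<^esub> \<one>\<^bsub>H\<^esub>\<rparr>"

definition quot_emb :: "('a, 'm) monoid_scheme \<Rightarrow> 'a \<Rightarrow> ('a \<times> 'a) set" where
  "quot_emb H a = frac H \<one>\<^bsub>H\<^esub> a"

text \<open>\<open>H\<close> viewed as a subset of its quotient group.\<close>

definition emb_carrier :: "('a, 'm) monoid_scheme \<Rightarrow> ('a \<times> 'a) set set" where
  "emb_carrier H = quot_emb H ` carrier H"

context ore_monoid
begin

lemma left_oreE:
  assumes "a \<in> carrier H" "b \<in> carrier H"
  obtains u v where "u \<in> carrier H" "v \<in> carrier H" "u \<otimes> a = v \<otimes> b"
  using left_ore[OF assms] unfolding r_coset_def by auto

lemma right_oreE:
  assumes "a \<in> carrier H" "b \<in> carrier H"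
  obtains u v where "u \<in> carrier H" "v \<in> carrier H" "a \<otimes> u = b \<otimes> v"
  using right_ore[OF assms] unfolding l_coset_def by auto

lemma frac_relI:
  assumes "a \<in> carrier H" "b \<in> carrier H" "c \<in> carrier H" "d \<in> carrier H"
    "u \<in> carrier H" "v \<in> carrier H" "u \<otimes> a = v \<otimes> c" "u \<otimes> b = v \<otimes> d"
  shows "((a, b), (c, d)) \<in> frac_rel H"
  using assms unfolding frac_rel_def by auto

lemma frac_relE:
  assumes "((a, b), (c, d)) \<in> frac_rel H"
  obtains u v where "a \<in> carrier H" "b \<in> carrier H" "c \<in> carrier H" "d \<in> carrier H"
    "u \<in> carrier H" "v \<in> carrier H" "u \<otimes> a = v \<otimes> c" "u \<otimes> b = v \<otimes> d"
  using assms unfolding frac_rel_def by auto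

lemma frac_rel_transfer:
  assumes "((a, b), (c, d)) \<in> frac_rel H" and xy: "x \<in> carrier H" "y \<in> carrier H"
    and eq: "x \<otimes> a = y \<otimes> c"
  shows "x \<otimes> b = y \<otimes> d"
proof -
  obtain s t where car: "a \<in> carrier H" "b \<in> carrier H" "c \<in> carrier H" "d \<in> carrier H"
    "s \<in> carrier H" "t \<in> carrier H" and st: "s \<otimes> a = t \<otimes> c" "s \<otimes> b = t \<otimes> d"
    using assms(1) by (rule frac_relE)
  obtain m n where mn: "m \<in> carrier H" "n \<in> carrier H" "m \<otimes> x = n \<otimes> s"
    using left_oreE[OF xy(1) car(5)] .
  have "(m \<otimes> y) \<otimes> c = (n \<otimes> t) \<otimes> c"
    by (metis car xy mn st(1) eq m_assoc)
  then have "m \<otimes> y = n \<otimes> t"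
    using r_cancel car xy mn by blast
  then have "m \<otimes> (x \<otimes> b) = m \<otimes> (y \<otimes> d)"
    by (metis car xy mn st(2) m_assoc)
  then show ?thesis
    using l_cancel car xy mn by blast
qed

lemma equiv_frac_rel: "equiv (carrier H \<times> carrier H) (frac_rel H)"
proof (rule equivI)
  show "frac_rel H \<subseteq> (carrier H \<times> carrier H) \<times> (carrier H \<times> carrier H)"
    unfolding frac_rel_def by auto
  show "refl_on (carrier H \<times> carrier H) (frac_rel H)"
    unfolding refl_on_def frac_rel_def by auto
  show "sym (frac_rel H)"
    by (rule symI) (auto elim!: frac_relE intro: frac_relI[OF _ _ _ _ _ _ sym sym])
  show "trans (frac_rel H)"
  proof (rule transI, clarify)
    fix a b c d e f
    assume 1: "((a, b), (c, d)) \<in> frac_rel H" and 2: "((c, d), (e, f)) \<in> frac_rel H"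
    have car: "a \<in> carrier H" "b \<in> carrier H" "c \<in> carrier H" "d \<in> carrier H" "e \<in> carrier H"
      "f \<in> carrier H"
      using 1 2 unfolding frac_rel_def by auto
    obtain u v where uv: "u \<in> carrier H" "v \<in> carrier H" "u \<otimes> a = v \<otimes> c" "u \<otimes> b = v \<otimes> d"
      using 1 by (rule frac_relE)
    obtain m n where mn: "m \<in> carrier H" "n \<in> carrier H" "m \<otimes> (v \<otimes> c) = n \<otimes> e"
      by (rule left_oreE[of "v \<otimes> c" e]) (use car uv in auto)
    have "(m \<otimes> v) \<otimes> d = n \<otimes> f"
      by (rule frac_rel_transfer[OF 2]) (use car uv mn in \<open>auto simp: m_assoc\<close>)
    then show "((a, b), (e, f)) \<in> frac_rel H"
      by (intro frac_relI[where u = "m \<otimes> u" and v = n]) (use car uv mn in \<open>auto simp: m_assoc\<close>)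
  qed
qed

lemma frac_eq_iff:
  assumes "a \<in> carrier H" "b \<in> carrier H" "c \<in> carrier H" "d \<in> carrier H"
  shows "frac H a b = frac H c d \<longleftrightarrow> ((a, b), (c, d)) \<in> frac_rel H"
  unfolding frac_def using eq_equiv_class_iff[OF equiv_frac_rel] assms by auto

lemma frac_cancel:
  assumes "w \<in> carrier H" "a \<in> carrier H" "b \<in> carrier H"
  shows "frac H (w \<otimes> a) (w \<otimes> b) = frac H a b"
  using assms by (subst frac_eq_iff) (auto intro!: frac_relI[where u = \<one> and v = w])

lemma frac_in_quot_group:
  "a \<in> carrier H \<Longrightarrow> b \<in> carrier H \<Longrightarrow> frac H a b \<in> carrier (quot_group H)"
  unfolding quot_group_def frac_def by (auto intro: quotientI)

lemma quot_groupE: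
  assumes "X \<in> carrier (quot_group H)"
  obtains a b where "a \<in> carrier H" "b \<in> carrier H" "X = frac H a b"
  using assms unfolding quot_group_def frac_def by (auto elim!: quotientE)

lemma frac_mult_frac:
  assumes car: "a \<in> carrier H" "b \<in> carrier H" "c \<in> carrier H" "d \<in> carrier H"
    and uv: "u \<in> carrier H" "v \<in> carrier H" "u \<otimes> b = v \<otimes> c"
  shows "frac H a b \<otimes>\<^bsub>quot_group H\<^esub> frac H c d = frac H (u \<otimes> a) (v \<otimes> d)"
proof -
  have eq: "frac H (u' \<otimes> a') (v' \<otimes> d') = frac H (u \<otimes> a) (v \<otimes> d)"
    if "((a, b), (a', b')) \<in> frac_rel H" "((c, d), (c', d')) \<in> frac_rel H"
      "u' \<in> carrier H" "v' \<in> carrier H" "u' \<otimes> b' = v' \<otimes> c'" for a' b' c' d' u' v'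
  proof -
    have car': "a' \<in> carrier H" "b' \<in> carrier H" "c' \<in> carrier H" "d' \<in> carrier H"
      using that unfolding frac_rel_def by auto
    have u': "u' \<in> carrier H" by (rule that(3))
    obtain x y where xy: "x \<in> carrier H" "y \<in> carrier H" "x \<otimes> (u \<otimes> a) = y \<otimes> (u' \<otimes> a')"
      by (rule left_oreE[of "u \<otimes> a" "u' \<otimes> a'"]) (use car car' uv u' in auto)
    have "(x \<otimes> u) \<otimes> b = (y \<otimes> u') \<otimes> b'"
      by (rule frac_rel_transfer[OF that(1)]) (use xy uv that car car' in \<open>auto simp: m_assoc\<close>)
    then have "(x \<otimes> v) \<otimes> c = (y \<otimes> v') \<otimes> c'"
      using xy uv that car car' by (simp add: m_assoc)
    then have "(x \<otimes> v) \<otimes> d = (y \<otimes> v') \<otimes> d'"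
      by (rule frac_rel_transfer[OF that(2), rotated -1]) (use xy uv that in auto)
    then have "((u \<otimes> a, v \<otimes> d), (u' \<otimes> a', v' \<otimes> d')) \<in> frac_rel H"
      by (intro frac_relI[where u = x and v = y]) (use xy uv that car car' in \<open>auto simp: m_assoc\<close>)
    then show ?thesis
      using frac_eq_iff[of "u \<otimes> a" "v \<otimes> d" "u' \<otimes> a'" "v' \<otimes> d'"] car car' uv that by simp
  qed
  have "((a, b), (a, b)) \<in> frac_rel H" "((c, d), (c, d)) \<in> frac_rel H"
    using equiv_frac_rel car unfolding equiv_def refl_on_def by auto
  then have "{frac H (u' \<otimes> a') (v' \<otimes> d') | a' b' c' d' u' v'.
     (a', b') \<in> frac H a b \<and> (c', d') \<in> frac H c d \<and> u' \<in> carrier H \<and> v' \<in> carrier H \<and>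
     u' \<otimes> b' = v' \<otimes> c'} = {frac H (u \<otimes> a) (v \<otimes> d)}" (is "?S = _")
  proof (intro equalityI subsetI)
    fix Z assume "Z \<in> ?S"
    then show "Z \<in> {frac H (u \<otimes> a) (v \<otimes> d)}"
      unfolding frac_def[of H a b] frac_def[of H c d] using eq by auto
  next
    fix Z assume "Z \<in> {frac H (u \<otimes> a) (v \<otimes> d)}"
    moreover have "(a, b) \<in> frac H a b" "(c, d) \<in> frac H c d"
      using equiv_frac_rel car unfolding frac_def equiv_def refl_on_def by auto
    ultimately show "Z \<in> ?S"
      using uv by blast
  qed
  then show ?thesis
    unfolding quot_group_def frac_mult_def by simp
qed

lemma frac_mult_chain:
  assumes "a \<in> carrier H" "b \<in> carrier H" "c \<in> carrier H"
  shows "frac H a b \<otimes>\<^bsub>quot_group H\<^esub> frac H b c = frac H a c"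
  using frac_mult_frac[of a b b c \<one> \<one>] assms by simp

lemma quot_group_chain:
  assumes "X \<in> carrier (quot_group H)" "Y \<in> carrier (quot_group H)"
  obtains a b c where "a \<in> carrier H" "b \<in> carrier H" "c \<in> carrier H"
    "X = frac H a b" "Y = frac H b c"
proof -
  obtain a b where ab: "a \<in> carrier H" "b \<in> carrier H" "X = frac H a b"
    using assms(1) by (rule quot_groupE)
  obtain c d where cd: "c \<in> carrier H" "d \<in> carrier H" "Y = frac H c d"
    using assms(2) by (rule quot_groupE)
  obtain u v where uv: "u \<in> carrier H" "v \<in> carrier H" "u \<otimes> b = v \<otimes> c"
    using left_oreE[OF ab(2) cd(1)] .
  have "X = frac H (u \<otimes> a) (u \<otimes> b)" "Y = frac H (u \<otimes> b) (v \<otimes> d)"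
    using frac_cancel[OF uv(1) ab(1,2)] frac_cancel[OF uv(2) cd(1,2)] ab(3) cd(3) uv(3) by simp_all
  then show ?thesis
    by (intro that) (use ab cd uv in auto)
qed

lemma one_quot_group:
  assumes "a \<in> carrier H"
  shows "\<one>\<^bsub>quot_group H\<^esub> = frac H a a"
  using frac_cancel[of a \<one> \<one>] assms by (simp add: quot_group_def)

lemma group_quot_group: "group (quot_group H)"
proof (rule groupI)
  fix X Y assume "X \<in> carrier (quot_group H)" "Y \<in> carrier (quot_group H)"
  then obtain a b c where "a \<in> carrier H" "b \<in> carrier H" "c \<in> carrier H"
    "X = frac H a b" "Y = frac H b c"
    by (rule quot_group_chain)
  then show "X \<otimes>\<^bsub>quot_group H\<^esub> Y \<in> carrier (quot_group H)"
    by (simp add: frac_mult_chain frac_in_quot_group)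
next
  show "\<one>\<^bsub>quot_group H\<^esub> \<in> carrier (quot_group H)"
    using one_quot_group[of \<one>] frac_in_quot_group by simp
next
  fix X Y Z
  assume X: "X \<in> carrier (quot_group H)" and Y: "Y \<in> carrier (quot_group H)"
    and Z: "Z \<in> carrier (quot_group H)"
  obtain a b c where abc: "a \<in> carrier H" "b \<in> carrier H" "c \<in> carrier H"
    "X = frac H a b" "Y = frac H b c"
    using quot_group_chain[OF X Y] .
  obtain d e where de: "d \<in> carrier H" "e \<in> carrier H" "Z = frac H d e"
    using Z by (rule quot_groupE)
  obtain u v where uv: "u \<in> carrier H" "v \<in> carrier H" "u \<otimes> c = v \<otimes> d"
    using left_oreE[OF abc(3) de(1)] .
  have "X = frac H (u \<otimes> a) (u \<otimes> b)" "Y = frac H (u \<otimes> b) (u \<otimes> c)" "Z = frac H (u \<otimes> c) (v \<otimes> e)"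
    using frac_cancel[OF uv(1) abc(1,2)] frac_cancel[OF uv(1) abc(2,3)]
      frac_cancel[OF uv(2) de(1,2)] abc(4,5) de(3) uv(3) by simp_all
  then show "X \<otimes>\<^bsub>quot_group H\<^esub> Y \<otimes>\<^bsub>quot_group H\<^esub> Z = X \<otimes>\<^bsub>quot_group H\<^esub> (Y \<otimes>\<^bsub>quot_group H\<^esub> Z)"
    using abc de uv by (simp add: frac_mult_chain)
next
  fix X assume "X \<in> carrier (quot_group H)"
  then obtain a b where ab: "a \<in> carrier H" "b \<in> carrier H" "X = frac H a b"
    by (rule quot_groupE)
  then show "\<one>\<^bsub>quot_group H\<^esub> \<otimes>\<^bsub>quot_group H\<^esub> X = X"
    using one_quot_group[of a] by (simp add: frac_mult_chain)
  show "\<exists>Y\<in>carrier (quot_group H). Y \<otimes>\<^bsub>quot_group H\<^esub> X = \<one>\<^bsub>quot_group H\<^esub>"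
    using ab one_quot_group[of b]
    by (intro bexI[of _ "frac H b a"]) (auto simp: frac_mult_chain frac_in_quot_group)
qed

lemma inv_frac:
  assumes "a \<in> carrier H" "b \<in> carrier H"
  shows "inv\<^bsub>quot_group H\<^esub> (frac H a b) = frac H b a"
  using assms group.inv_equality[OF group_quot_group, of "frac H b a" "frac H a b"]
    one_quot_group[of b]
  by (auto simp: frac_mult_chain frac_in_quot_group)

lemma quot_emb_closed: "a \<in> carrier H \<Longrightarrow> quot_emb H a \<in> carrier (quot_group H)"
  unfolding quot_emb_def by (simp add: frac_in_quot_group)

lemma quot_emb_mult:
  assumes "a \<in> carrier H" "b \<in> carrier H"
  shows "quot_emb H (a \<otimes> b) = quot_emb H a \<otimes>\<^bsub>quot_group H\<^esub> quot_emb H b"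
  using frac_mult_frac[of \<one> a \<one> b \<one> a] assms unfolding quot_emb_def by simp

lemma quot_emb_one: "quot_emb H \<one> = \<one>\<^bsub>quot_group H\<^esub>"
  unfolding quot_emb_def quot_group_def by simp

lemma inj_on_quot_emb: "inj_on (quot_emb H) (carrier H)"
proof (rule inj_onI)
  fix a b assume ab: "a \<in> carrier H" "b \<in> carrier H" and "quot_emb H a = quot_emb H b"
  then have "((\<one>, a), (\<one>, b)) \<in> frac_rel H"
    unfolding quot_emb_def using frac_eq_iff by simp
  from frac_rel_transfer[OF this, of \<one> \<one>] show "a = b"
    using ab by simp
qed

lemma frac_eq_inv_mult:
  assumes "a \<in> carrier H" "b \<in> carrier H"
  shows "frac H a b = inv\<^bsub>quot_group H\<^esub> (quot_emb H a) \<otimes>\<^bsub>quot_group H\<^esub> quot_emb H b"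
  using assms unfolding quot_emb_def by (simp add: inv_frac frac_mult_chain)

lemma quot_group_left_fraction:
  assumes "x \<in> carrier (quot_group H)"
  shows "\<exists>a\<in>carrier H. \<exists>b\<in>carrier H.
    x = inv\<^bsub>quot_group H\<^esub> (quot_emb H a) \<otimes>\<^bsub>quot_group H\<^esub> quot_emb H b"
  using assms frac_eq_inv_mult by (metis quot_groupE)

lemma quot_group_right_fraction:
  assumes "x \<in> carrier (quot_group H)"
  shows "\<exists>a\<in>carrier H. \<exists>b\<in>carrier H.
    x = quot_emb H b \<otimes>\<^bsub>quot_group H\<^esub> inv\<^bsub>quot_group H\<^esub> (quot_emb H a)"
proof -
  interpret Q: group "quot_group H" by (rule group_quot_group)
  obtain c d where cd: "c \<in> carrier H" "d \<in> carrier H"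
    "x = inv\<^bsub>quot_group H\<^esub> (quot_emb H c) \<otimes>\<^bsub>quot_group H\<^esub> quot_emb H d"
    using quot_group_left_fraction[OF assms] by auto
  obtain a b where ab: "a \<in> carrier H" "b \<in> carrier H" "d \<otimes> a = c \<otimes> b"
    using right_oreE[OF cd(2,1)] .
  have "quot_emb H d \<otimes>\<^bsub>quot_group H\<^esub> quot_emb H a = quot_emb H c \<otimes>\<^bsub>quot_group H\<^esub> quot_emb H b"
    using ab cd by (metis quot_emb_mult)
  then have "x \<otimes>\<^bsub>quot_group H\<^esub> quot_emb H a = quot_emb H b"
    using ab cd by (simp add: Q.m_assoc Q.inv_solve_left' quot_emb_closed)
  then have "x = quot_emb H b \<otimes>\<^bsub>quot_group H\<^esub> inv\<^bsub>quot_group H\<^esub> (quot_emb H a)"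
    using ab assms by (metis Q.inv_solve_right quot_emb_closed)
  then show ?thesis using ab by auto
qed

end

section \<open>Fractional ideals, divisorial ideals and \<open>v\<close>-multiplication\<close>

definition lcolon ::
  "('a, 'm) monoid_scheme \<Rightarrow> ('a \<times> 'a) set set \<Rightarrow> ('a \<times> 'a) set set \<Rightarrow> ('a \<times> 'a) set set" where
  "lcolon H A B = {x \<in> carrier (quot_group H). x <#\<^bsub>quot_group H\<^esub> B \<subseteq> A}"

definition rcolon ::
  "('a, 'm) monoid_scheme \<Rightarrow> ('a \<times> 'a) set set \<Rightarrow> ('a \<times> 'a) set set \<Rightarrow> ('a \<times> 'a) set set" where
  "rcolon H A B = {x \<in> carrier (quot_group H). B #>\<^bsub>quot_group H\<^esub> x \<subseteq> A}"

definition fractional_ideal :: "('a, 'm) monoid_scheme \<Rightarrow> ('a \<times> 'a) set set \<Rightarrow> bool" where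
  "fractional_ideal H A \<longleftrightarrow> A \<subseteq> carrier (quot_group H) \<and>
     emb_carrier H <#>\<^bsub>quot_group H\<^esub> A = A \<and> A <#>\<^bsub>quot_group H\<^esub> emb_carrier H = A \<and>
     (\<exists>a\<in>emb_carrier H. a <#\<^bsub>quot_group H\<^esub> A \<subseteq> emb_carrier H) \<and>
     (\<exists>b\<in>emb_carrier H. A #>\<^bsub>quot_group H\<^esub> b \<subseteq> emb_carrier H)"

definition monoid_ideal :: "('a, 'm) monoid_scheme \<Rightarrow> ('a \<times> 'a) set set \<Rightarrow> bool" where
  "monoid_ideal H A \<longleftrightarrow> fractional_ideal H A \<and> A \<subseteq> emb_carrier H"

definition v_lr :: "('a, 'm) monoid_scheme \<Rightarrow> ('a \<times> 'a) set set \<Rightarrow> ('a \<times> 'a) set set" where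
  "v_lr H A = lcolon H (emb_carrier H) (rcolon H (emb_carrier H) A)"

definition v_rl :: "('a, 'm) monoid_scheme \<Rightarrow> ('a \<times> 'a) set set \<Rightarrow> ('a \<times> 'a) set set" where
  "v_rl H A = rcolon H (emb_carrier H) (lcolon H (emb_carrier H) A)"

definition divisorial_ideals :: "('a, 'm) monoid_scheme \<Rightarrow> ('a \<times> 'a) set set set" where
  "divisorial_ideals H = {A. monoid_ideal H A \<and> v_lr H A = v_rl H A \<and> v_lr H A = A}"

definition colons_agree :: "('a, 'm) monoid_scheme \<Rightarrow> bool" where
  "colons_agree H \<longleftrightarrow>
     (\<forall>C. fractional_ideal H C \<longrightarrow> lcolon H (emb_carrier H) C = rcolon H (emb_carrier H) C)"

text \<open>The next four definitions have their intended meaning under \<open>colons_agree H\<close>. In that case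
  \<open>v_lr\<close> and \<open>v_rl\<close> coincide on fractional ideals, so it does not matter which of the two (and
  which of the two colons in \<open>A\<^sup>-\<^sup>1\<close>) is chosen.\<close>

definition v_mult ::
  "('a, 'm) monoid_scheme \<Rightarrow> ('a \<times> 'a) set set \<Rightarrow> ('a \<times> 'a) set set \<Rightarrow> ('a \<times> 'a) set set" where
  "v_mult H A B = v_lr H (A <#>\<^bsub>quot_group H\<^esub> B)"

definition ideal_inv :: "('a, 'm) monoid_scheme \<Rightarrow> ('a \<times> 'a) set set \<Rightarrow> ('a \<times> 'a) set set" where
  "ideal_inv H A = lcolon H (emb_carrier H) A"

definition v_invertible :: "('a, 'm) monoid_scheme \<Rightarrow> ('a \<times> 'a) set set \<Rightarrow> bool" where
  "v_invertible H A \<longleftrightarrow>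
     v_mult H A (ideal_inv H A) = emb_carrier H \<and> v_mult H (ideal_inv H A) A = emb_carrier H"

definition v_invertible_ideals :: "('a, 'm) monoid_scheme \<Rightarrow> ('a \<times> 'a) set set monoid" where
  "v_invertible_ideals H = \<lparr>carrier = {A \<in> divisorial_ideals H. v_invertible H A},
     monoid.mult = v_mult H, one = emb_carrier H\<rparr>"

definition principal_set :: "('a, 'm) monoid_scheme \<Rightarrow> 'a \<Rightarrow> ('a \<times> 'a) set set" where
  "principal_set H a = quot_emb H a <#\<^bsub>quot_group H\<^esub> emb_carrier H"

section \<open>Normalizing Krull monoids\<close>

definition normalizing :: "('a, 'm) monoid_scheme \<Rightarrow> bool" where
  "normalizing H \<longleftrightarrow> (\<forall>a\<in>carrier H. a <#\<^bsub>H\<^esub> carrier H = carrier H #>\<^bsub>H\<^esub> a)"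

definition completely_integrally_closed :: "('a, 'm) monoid_scheme \<Rightarrow> bool" where
  "completely_integrally_closed H \<longleftrightarrow>
     (\<forall>A. monoid_ideal H A \<and> A \<noteq> {} \<longrightarrow> lcolon H A A = emb_carrier H \<and> rcolon H A A = emb_carrier H)"

definition v_noetherian :: "('a, 'm) monoid_scheme \<Rightarrow> bool" where
  "v_noetherian H \<longleftrightarrow>
     (\<forall>A :: nat \<Rightarrow> _. (\<forall>n. A n \<in> divisorial_ideals H \<and> A n \<subseteq> A (Suc n)) \<longrightarrow>
        (\<exists>N. \<forall>n\<ge>N. A n = A N))"

definition krull_monoid :: "('a, 'm) monoid_scheme \<Rightarrow> bool" where
  "krull_monoid H \<longleftrightarrow> completely_integrally_closed H \<and> v_noetherian H"

section \<open>Divisor homomorphisms and divisor theories\<close>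

text \<open>The library's \<open>a divides b\<close> means \<open>b \<in> a H\<close>, i.e. it is left divisibility.\<close>

definition right_divides :: "('a, 'm) monoid_scheme \<Rightarrow> 'a \<Rightarrow> 'a \<Rightarrow> bool" where
  "right_divides H a b \<longleftrightarrow> (\<exists>c\<in>carrier H. b = c \<otimes>\<^bsub>H\<^esub> a)"

definition divisor_hom ::
  "('a, 'm) monoid_scheme \<Rightarrow> ('d, 'e) monoid_scheme \<Rightarrow> ('a \<Rightarrow> 'd) \<Rightarrow> bool" where
  "divisor_hom H D \<phi> \<longleftrightarrow> \<phi> \<in> hom H D \<and> \<phi> \<one>\<^bsub>H\<^esub> = \<one>\<^bsub>D\<^esub> \<and>
     (\<forall>u\<in>carrier H. \<forall>v\<in>carrier H.
        (\<phi> u divides\<^bsub>D\<^esub> \<phi> v \<longrightarrow> u divides\<^bsub>H\<^esub> v) \<and>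
        (right_divides D (\<phi> u) (\<phi> v) \<longrightarrow> right_divides H u v))"

text \<open>\<open>D = \<F>(P)\<close>: every element of \<open>D\<close> is \<open>\<Prod>p\<in>P. p ^ \<nu> p\<close> for a unique finitely supported exponent
  function \<open>\<nu>\<close>. The product is taken over the support, as \<open>finprod\<close> is only meaningful on finite
  index sets.\<close>

definition free_abelian_monoid :: "('d, 'e) monoid_scheme \<Rightarrow> 'd set \<Rightarrow> bool" where
  "free_abelian_monoid D P \<longleftrightarrow> comm_monoid D \<and> P \<subseteq> carrier D \<and>
     (\<forall>x\<in>carrier D. \<exists>!\<nu> :: 'd \<Rightarrow> nat. finite {p. \<nu> p \<noteq> 0} \<and> {p. \<nu> p \<noteq> 0} \<subseteq> P \<and>
        x = (\<Otimes>\<^bsub>D\<^esub>p\<in>{p. \<nu> p \<noteq> 0}. p [^]\<^bsub>D\<^esub> \<nu> p))"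

text \<open>In a free abelian monoid \<open>1\<close> is the only unit, so a greatest common divisor is unique.\<close>

definition is_gcd :: "('d, 'e) monoid_scheme \<Rightarrow> 'd \<Rightarrow> 'd set \<Rightarrow> bool" where
  "is_gcd D g Y \<longleftrightarrow> g \<in> carrier D \<and> (\<forall>y\<in>Y. g divides\<^bsub>D\<^esub> y) \<and>
     (\<forall>d\<in>carrier D. (\<forall>y\<in>Y. d divides\<^bsub>D\<^esub> y) \<longrightarrow> d divides\<^bsub>D\<^esub> g)"

text \<open>HOL cannot quantify over the type of \<open>D\<close> inside a formula. That \<open>H\<close> has a divisor theory is
  therefore expressed by existence at the type of \<open>v_invertible_ideals H\<close> (large enough to hold one
  if there is any), and what follows from a divisor theory is stated for \<open>D\<close> over every type.\<close>

definition divisor_theory ::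
  "('a, 'm) monoid_scheme \<Rightarrow> ('d, 'e) monoid_scheme \<Rightarrow> ('a \<Rightarrow> 'd) \<Rightarrow> bool" where
  "divisor_theory H D \<phi> \<longleftrightarrow> divisor_hom H D \<phi> \<and>
     (\<exists>P. free_abelian_monoid D P \<and>
        (\<forall>p\<in>P. \<exists>X. X \<subseteq> carrier H \<and> finite X \<and> X \<noteq> {} \<and> is_gcd D p (\<phi> ` X)))"

end

theory Submission
  imports Defs
begin

text \<open>A divisor homomorphism into a free abelian monoid is a family of valuations: the exponents
  \<open>v\<^sub>p\<close> of \<open>\<phi> a\<close> are additive, only finitely many are nonzero at each \<open>a\<close>, and \<open>a\<close> divides \<open>b\<close> on
  either side as soon as \<open>v\<^sub>p a \<le> v\<^sub>p b\<close> for all \<open>p\<close>. Additivity ignores the order of factors, so left and right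
  multiples of \<open>a\<close> coincide and \<open>H\<close> is normalizing. The valuations extend to integer-valued
  homomorphisms on the quotient group, and \<open>H\<close> is the set where all of them are nonnegative. If
  \<open>x A \<subseteq> A \<subseteq> H\<close> and \<open>c \<in> A\<close>, then \<open>n v\<^sub>p(x) + v\<^sub>p(c) \<ge> 0\<close> for all \<open>n\<close>, whence \<open>x \<in> H\<close>. And the colon
  \<open>(H :\<^sub>r A)\<close> only depends on the minima of the \<open>v\<^sub>p\<close> on \<open>A\<close>, all of which are attained on some finite \<open>E \<subseteq> A\<close>;
  for the union \<open>A\<close> of an ascending chain of \<open>v\<close>-ideals, \<open>E\<close> lies in a member of the chain, and the
  chain is constant from there on. This is \<open>normalizing_krull_divisor_hom\<close>.

  Conversely let \<open>H\<close> be a normalizing Krull monoid. Then \<open>H\<close> is invariant under conjugation in its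
  quotient group, so \<open>x y \<in> H\<close> and \<open>y x \<in> H\<close> are equivalent: left and right colons agree, and the
  \<open>v\<close>-closure is the closure operator of a single symmetric Galois connection. Complete integral
  closedness makes every nonempty \<open>v\<close>-ideal \<open>v\<close>-invertible, so that one such ideal contains another
  exactly if it divides it, on both sides. The ascending chain condition then
  factors every nonempty \<open>v\<close>-ideal into maximal ones. These are prime, and two different ones commute:
  \<open>P \<cdot>\<^sub>v Q\<close> is contained in \<open>Q\<close>, hence equals \<open>Q \<cdot>\<^sub>v C\<close> for some \<open>C\<close>, and \<open>C \<subseteq> P\<close> because \<open>P\<close> is prime
  and does not contain \<open>Q\<close>; so \<open>P \<cdot>\<^sub>v Q \<subseteq> Q \<cdot>\<^sub>v P\<close>. So \<open>v\<close>-multiplication is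
  commutative even though \<open>H\<close> need not be, and unique factorization follows from primality
  (\<open>v_ideal_monoid_free\<close>).
  Finally \<open>a H\<close> contains \<open>b H\<close> exactly if \<open>a\<close> divides \<open>b\<close>, and by the chain condition each nonempty \<open>v\<close>-ideal is the
  \<open>v\<close>-closure of a finite set, i.e. the gcd of finitely many principal ideals
  (\<open>divisor_theory_principal_set\<close>).\<close>

section \<open>Free abelian monoids\<close>

text \<open>Unique factorization from primality. A product over finitely many elements of \<open>P\<close> can be split
  as \<open>q\<^sup>k r\<close> with \<open>q\<close> not dividing \<open>r\<close>, since \<open>q\<close> is prime and divides no other element of \<open>P\<close>; by
  cancellation the exponent \<open>k\<close> is determined by the product.\<close>

lemma (in comm_monoid_cancel) free_abelian_monoid_primes:
  assumes P: "P \<subseteq> carrier G"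
    and gen: "\<And>x. x \<in> carrier G \<Longrightarrow> \<exists>ps. set ps \<subseteq> P \<and> x = foldr (\<otimes>) ps \<one>"
    and prime: "\<And>p a b. p \<in> P \<Longrightarrow> a \<in> carrier G \<Longrightarrow> b \<in> carrier G \<Longrightarrow> p divides a \<otimes> b \<Longrightarrow>
      p divides a \<or> p divides b"
    and distinct: "\<And>p q. p \<in> P \<Longrightarrow> q \<in> P \<Longrightarrow> p divides q \<Longrightarrow> p = q"
    and nonunit: "\<And>p. p \<in> P \<Longrightarrow> \<not> p divides \<one>"
  shows "free_abelian_monoid G P"
proof -
  let ?prod = "\<lambda>\<nu>. \<Otimes>p\<in>{p. \<nu> p \<noteq> (0::nat)}. p [^] \<nu> p"
  have list_prod: "foldr (\<otimes>) ps \<one> = (\<Otimes>p\<in>F. p [^] count_list ps p)"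
    if "set ps \<subseteq> F" "F \<subseteq> P" "finite F" for ps F
    using that
  proof (induction ps)
    case Nil
    then show ?case by (simp add: finprod_one_eqI)
  next
    case (Cons a ps)
    have FG: "F \<subseteq> carrier G" using Cons.prems P by auto
    then have car: "(\<lambda>p. p [^] count_list ps p) \<in> F \<rightarrow> carrier G"
      "(\<lambda>p. if a = p then p else \<one>) \<in> F \<rightarrow> carrier G" by auto
    have "(\<Otimes>p\<in>F. p [^] count_list (a # ps) p)
        = (\<Otimes>p\<in>F. (if a = p then p else \<one>) \<otimes> p [^] count_list ps p)"
      by (rule finprod_cong') (use FG in \<open>auto simp: m_comm\<close>)
    also have "\<dots> = (\<Otimes>p\<in>F. if a = p then p else \<one>) \<otimes> (\<Otimes>p\<in>F. p [^] count_list ps p)"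
      by (rule finprod_multf[OF car(2,1)])
    also have "(\<Otimes>p\<in>F. if a = p then p else \<one>) = a"
      using finprod_singleton[of a F "\<lambda>p. p"] Cons.prems FG by auto
    finally show ?case using Cons by simp
  qed
  have not_dvd_pow: "\<not> q divides p [^] n" if "p \<in> P" "q \<in> P" "p \<noteq> q" for p q and n :: nat
  proof (induction n)
    case 0
    then show ?case using nonunit that by simp
  next
    case (Suc n)
    then show ?case using prime[of q "p [^] n" p] distinct[of q p] that P by auto
  qed
  have not_dvd_prod: "\<not> q divides (\<Otimes>p\<in>F. p [^] \<nu> p)"
    if "finite F" "F \<subseteq> P - {q}" "q \<in> P" for F q and \<nu> :: "'a \<Rightarrow> nat"
    using that
  proof (induction F)
    case empty
    then show ?case using nonunit by simp
  next
    case (insert p F)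
    have "(\<lambda>p. p [^] \<nu> p) \<in> F \<rightarrow> carrier G" "p \<in> carrier G" using insert.prems P by auto
    then show ?case using insert not_dvd_pow[of p q "\<nu> p"]
        prime[of q "p [^] \<nu> p" "\<Otimes>p\<in>F. p [^] \<nu> p"] by auto
  qed
  have split: "\<exists>r\<in>carrier G. ?prod \<nu> = q [^] \<nu> q \<otimes> r \<and> \<not> q divides r"
    if "finite {p. \<nu> p \<noteq> 0}" "{p. \<nu> p \<noteq> 0} \<subseteq> P" "q \<in> P" for \<nu> q
  proof -
    let ?S = "{p. \<nu> p \<noteq> 0}" and ?r = "\<Otimes>p\<in>{p. \<nu> p \<noteq> 0} - {q}. p [^] \<nu> p"
    have car: "(\<lambda>p. p [^] \<nu> p) \<in> ?S - {q} \<rightarrow> carrier G" using that P by auto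
    have q: "q \<in> carrier G" using that P by auto
    have "?prod \<nu> = q [^] \<nu> q \<otimes> ?r"
    proof (cases "\<nu> q = 0")
      case True
      then have "?S - {q} = ?S" by auto
      then show ?thesis using True car q by (metis finprod_closed l_one nat_pow_0)
    next
      case False
      then have "?S = insert q (?S - {q})" by auto
      then show ?thesis
        using finprod_insert[of "?S - {q}" q "\<lambda>p. p [^] \<nu> p"] car q that(1) by simp
    qed
    moreover have "\<not> q divides ?r" by (rule not_dvd_prod) (use that in auto)
    ultimately show ?thesis using finprod_closed[OF car] by (intro bexI[of _ ?r] conjI)
  qed
  have le: "a \<le> b"
    if eq: "q [^] a \<otimes> r = q [^] b \<otimes> s" and r: "r \<in> carrier G" and s: "s \<in> carrier G" "\<not> q divides s"
      and q: "q \<in> P" for q r s and a b :: nat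
  proof (rule ccontr)
    assume "\<not> a \<le> b"
    then obtain k where k: "a = b + Suc k" using less_imp_Suc_add not_le by force
    have qG: "q \<in> carrier G" using q P by auto
    have "q [^] a = q [^] b \<otimes> (q \<otimes> q [^] k)"
      unfolding k using qG by (simp add: nat_pow_mult[symmetric] m_comm m_lcomm)
    then have "q [^] b \<otimes> s = (q [^] b \<otimes> (q \<otimes> q [^] k)) \<otimes> r"
      using eq by simp
    then have "q [^] b \<otimes> s = q [^] b \<otimes> (q \<otimes> (q [^] k \<otimes> r))"
      using qG r by (simp only: m_assoc nat_pow_closed m_closed)
    then have "s = q \<otimes> (q [^] k \<otimes> r)" using qG r s
      by (metis l_cancel m_closed nat_pow_closed)
    then show False using s qG r by (metis dividesI m_closed nat_pow_closed)
  qed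
  have "\<exists>!\<nu>. finite {p. \<nu> p \<noteq> 0} \<and> {p. \<nu> p \<noteq> 0} \<subseteq> P \<and> x = ?prod \<nu>" if x: "x \<in> carrier G" for x
  proof (rule ex_ex1I)
    obtain ps where ps: "set ps \<subseteq> P" "x = foldr (\<otimes>) ps \<one>" using gen[OF x] by auto
    have "{p. count_list ps p \<noteq> 0} = set ps" by (auto simp: count_list_0_iff)
    then show "\<exists>\<nu>. finite {p. \<nu> p \<noteq> 0} \<and> {p. \<nu> p \<noteq> 0} \<subseteq> P \<and> x = ?prod \<nu>"
      using list_prod[of ps "set ps"] ps by (intro exI[of _ "count_list ps"]) simp
  next
    fix \<nu> \<mu>
    assume \<nu>: "finite {p. \<nu> p \<noteq> 0} \<and> {p. \<nu> p \<noteq> 0} \<subseteq> P \<and> x = ?prod \<nu>"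
      and \<mu>: "finite {p. \<mu> p \<noteq> 0} \<and> {p. \<mu> p \<noteq> 0} \<subseteq> P \<and> x = ?prod \<mu>"
    have "\<nu> q = \<mu> q" for q
    proof (cases "q \<in> P")
      case True
      obtain r where r: "r \<in> carrier G" "x = q [^] \<nu> q \<otimes> r" "\<not> q divides r"
        using split[of \<nu> q] \<nu> True by auto
      obtain s where s: "s \<in> carrier G" "x = q [^] \<mu> q \<otimes> s" "\<not> q divides s"
        using split[of \<mu> q] \<mu> True by auto
      show ?thesis
        using le[of q "\<nu> q" r "\<mu> q" s] le[of q "\<mu> q" s "\<nu> q" r] r s True by auto
    next
      case False
      then show ?thesis using \<nu> \<mu> by (metis (mono_tags, lifting) mem_Collect_eq subsetD)
    qed
    then show "\<nu> = \<mu>" by blast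
  qed
  then show ?thesis
    unfolding free_abelian_monoid_def using P comm_monoid_axioms by blast
qed

text \<open>Sending an element to its exponent function is additive and reflects divisibility: if the
  exponents of \<open>x\<close> are below those of \<open>y\<close>, their differences are the exponents of a cofactor.\<close>

lemma free_abelian_monoid_exponents:
  fixes D :: "('d, 'e) monoid_scheme"
  assumes "free_abelian_monoid D P"
  shows "\<exists>e :: 'd \<Rightarrow> 'd \<Rightarrow> nat. (\<forall>x\<in>carrier D. finite {p. e x p \<noteq> 0}) \<and>
    (\<forall>x\<in>carrier D. \<forall>y\<in>carrier D. \<forall>p. e (x \<otimes>\<^bsub>D\<^esub> y) p = e x p + e y p) \<and>
    (\<forall>x\<in>carrier D. \<forall>y\<in>carrier D. (\<forall>p. e x p \<le> e y p) \<longrightarrow> x divides\<^bsub>D\<^esub> y)"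
proof -
  interpret D: comm_monoid D using assms by (simp add: free_abelian_monoid_def)
  let ?prod = "\<lambda>\<nu>. \<Otimes>\<^bsub>D\<^esub>p\<in>{p. \<nu> p \<noteq> (0::nat)}. p [^]\<^bsub>D\<^esub> \<nu> p"
  define Q where "Q \<nu> \<longleftrightarrow> finite {p. \<nu> p \<noteq> 0} \<and> {p. \<nu> p \<noteq> 0} \<subseteq> P" for \<nu> :: "'d \<Rightarrow> nat"
  define e where "e x = (THE \<nu>. Q \<nu> \<and> x = ?prod \<nu>)" for x
  have P: "P \<subseteq> carrier D" using assms by (simp add: free_abelian_monoid_def)
  have ex1: "\<exists>!\<nu>. Q \<nu> \<and> x = ?prod \<nu>" if "x \<in> carrier D" for x
    using assms that unfolding free_abelian_monoid_def Q_def by (simp add: conj_assoc)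
  have e: "Q (e x)" "?prod (e x) = x" if "x \<in> carrier D" for x
    using theI'[OF ex1[OF that]] unfolding e_def by auto
  have e_eq: "e (?prod \<nu>) = \<nu>" if "Q \<nu>" for \<nu>
  proof -
    have "?prod \<nu> \<in> carrier D" using that P unfolding Q_def by (intro D.finprod_closed) auto
    from the1_equality[OF ex1[OF this]] show ?thesis unfolding e_def using that by simp
  qed
  have prod_F: "?prod \<nu> = (\<Otimes>\<^bsub>D\<^esub>p\<in>F. p [^]\<^bsub>D\<^esub> \<nu> p)"
    if "finite F" "{p. \<nu> p \<noteq> 0} \<subseteq> F" "F \<subseteq> P" for \<nu> F
    by (rule D.finprod_mono_neutral_cong_left) (use that P in auto)
  have Q_add: "Q (\<lambda>p. \<nu> p + \<mu> p)" if "Q \<nu>" "Q \<mu>" for \<nu> \<mu>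
  proof -
    have "{p. \<nu> p + \<mu> p \<noteq> 0} = {p. \<nu> p \<noteq> 0} \<union> {p. \<mu> p \<noteq> 0}" by auto
    then show ?thesis using that unfolding Q_def by auto
  qed
  have prod_add: "?prod (\<lambda>p. \<nu> p + \<mu> p) = ?prod \<nu> \<otimes>\<^bsub>D\<^esub> ?prod \<mu>" if "Q \<nu>" "Q \<mu>" for \<nu> \<mu>
  proof -
    let ?F = "{p. \<nu> p \<noteq> 0} \<union> {p. \<mu> p \<noteq> 0}"
    have F: "finite ?F" "?F \<subseteq> P" "?F \<subseteq> carrier D" using that P unfolding Q_def by auto
    have "?prod (\<lambda>p. \<nu> p + \<mu> p) = (\<Otimes>\<^bsub>D\<^esub>p\<in>?F. p [^]\<^bsub>D\<^esub> (\<nu> p + \<mu> p))"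
      by (rule prod_F) (use F in auto)
    also have "\<dots> = (\<Otimes>\<^bsub>D\<^esub>p\<in>?F. p [^]\<^bsub>D\<^esub> \<nu> p \<otimes>\<^bsub>D\<^esub> p [^]\<^bsub>D\<^esub> \<mu> p)"
      by (rule D.finprod_cong') (use F in \<open>auto simp: D.nat_pow_mult\<close>)
    also have "\<dots> = (\<Otimes>\<^bsub>D\<^esub>p\<in>?F. p [^]\<^bsub>D\<^esub> \<nu> p) \<otimes>\<^bsub>D\<^esub> (\<Otimes>\<^bsub>D\<^esub>p\<in>?F. p [^]\<^bsub>D\<^esub> \<mu> p)"
      by (rule D.finprod_multf) (use F in auto)
    also have "\<dots> = ?prod \<nu> \<otimes>\<^bsub>D\<^esub> ?prod \<mu>" using prod_F[of ?F] F by simp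
    finally show ?thesis .
  qed
  show ?thesis
  proof (intro exI[of _ e] conjI ballI allI impI)
    show "finite {p. e x p \<noteq> 0}" if "x \<in> carrier D" for x
      using e[OF that] by (simp add: Q_def)
    show "e (x \<otimes>\<^bsub>D\<^esub> y) p = e x p + e y p" if "x \<in> carrier D" "y \<in> carrier D" for x y p
      using e_eq[OF Q_add[OF e(1)[OF that(1)] e(1)[OF that(2)]]]
        prod_add[OF e(1)[OF that(1)] e(1)[OF that(2)]] e(2)[OF that(1)] e(2)[OF that(2)] by simp
    show "x divides\<^bsub>D\<^esub> y" if x: "x \<in> carrier D" and y: "y \<in> carrier D" and le: "\<forall>p. e x p \<le> e y p" for x y
    proof -
      let ?\<delta> = "\<lambda>p. e y p - e x p"
      have "{p. ?\<delta> p \<noteq> 0} \<subseteq> {p. e y p \<noteq> 0}" by auto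
      then have \<delta>: "Q ?\<delta>" using e(1)[OF y] unfolding Q_def using finite_subset by blast
      then have "?prod ?\<delta> \<in> carrier D" using P unfolding Q_def by (intro D.finprod_closed) auto
      moreover have "y = x \<otimes>\<^bsub>D\<^esub> ?prod ?\<delta>"
        using prod_add[OF e(1)[OF x] \<delta>] e(2)[OF x] e(2)[OF y] le by simp
      ultimately show ?thesis by (metis dividesI)
    qed
  qed
qed

section \<open>Valuations and the Krull property\<close>

lemma rcolon_antimono: "A \<subseteq> B \<Longrightarrow> rcolon H C B \<subseteq> rcolon H C A"
  unfolding rcolon_def r_coset_def by auto

context ore_monoid
begin

interpretation Q: group "quot_group H"
  by (rule group_quot_group)

lemma emb_carrier_subset: "emb_carrier H \<subseteq> carrier (quot_group H)"
  unfolding emb_carrier_def using quot_emb_closed by auto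

text \<open>The finiteness behind the chain condition. For nonempty \<open>A\<close> fix \<open>c \<in> A\<close>. For the finitely many \<open>p\<close> with
  \<open>w p c \<noteq> 0\<close> pick an element of \<open>A\<close> of least weight; for all other \<open>p\<close> the element \<open>c\<close> itself has the
  least possible weight \<open>0\<close>. The elements chosen have the same minimal weights as \<open>A\<close>, and whether
  \<open>a X \<in> H\<close> for all \<open>a\<close> only depends on these minima.\<close>

lemma finite_subset_same_rcolon:
  fixes w :: "'i \<Rightarrow> ('a \<times> 'a) set \<Rightarrow> int"
  assumes w_mult: "\<And>p X Y. X \<in> carrier (quot_group H) \<Longrightarrow> Y \<in> carrier (quot_group H) \<Longrightarrow>
      w p (X \<otimes>\<^bsub>quot_group H\<^esub> Y) = w p X + w p Y"
    and w_mem: "\<And>X. X \<in> carrier (quot_group H) \<Longrightarrow> X \<in> emb_carrier H \<longleftrightarrow> (\<forall>p. 0 \<le> w p X)"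
    and w_fin: "\<And>X. X \<in> emb_carrier H \<Longrightarrow> finite {p. w p X \<noteq> 0}"
    and A: "A \<subseteq> emb_carrier H"
  obtains E where "finite E" "E \<subseteq> A" "rcolon H (emb_carrier H) E = rcolon H (emb_carrier H) A"
proof (cases "A = {}")
  case True
  then show ?thesis using that[of "{}"] by simp
next
  case False
  then obtain c where c: "c \<in> A" by auto
  have AQ: "A \<subseteq> carrier (quot_group H)" using A emb_carrier_subset by auto
  have nonneg: "0 \<le> w p a" if "a \<in> A" for p a
    using w_mem that A AQ by auto
  have "\<exists>m. m \<in> A \<and> (\<forall>a. a \<in> A \<longrightarrow> nat (w p m) \<le> nat (w p a))" for p
    using ex_has_least_nat[of "\<lambda>m. m \<in> A" c "\<lambda>a. nat (w p a)"] c by blast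
  then obtain m where m: "\<And>p. m p \<in> A" "\<And>p a. a \<in> A \<Longrightarrow> nat (w p (m p)) \<le> nat (w p a)"
    by metis
  let ?E = "insert c (m ` {p. w p c \<noteq> 0})"
  have fin: "finite ?E" using w_fin c A by auto
  have sub: "?E \<subseteq> A" using c m by auto
  have "X \<in> rcolon H (emb_carrier H) A" if X: "X \<in> rcolon H (emb_carrier H) ?E" for X
  proof -
    have XQ: "X \<in> carrier (quot_group H)"
      and E: "\<And>e. e \<in> ?E \<Longrightarrow> e \<otimes>\<^bsub>quot_group H\<^esub> X \<in> emb_carrier H"
      using X unfolding rcolon_def r_coset_def by auto
    have "a \<otimes>\<^bsub>quot_group H\<^esub> X \<in> emb_carrier H" if a: "a \<in> A" for a
    proof -
      have "0 \<le> w p (a \<otimes>\<^bsub>quot_group H\<^esub> X)" for p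
      proof -
        have "\<exists>e\<in>?E. w p e \<le> w p a"
        proof (cases "w p c = 0")
          case True
          then show ?thesis using nonneg[OF a] by auto
        next
          case False
          then show ?thesis using m(2)[OF a, of p] nonneg[OF a, of p] nonneg[OF m(1), of p p] by auto
        qed
        then obtain e where e: "e \<in> ?E" "w p e \<le> w p a" by blast
        then have eQ: "e \<in> carrier (quot_group H)" using sub AQ by blast
        have "0 \<le> w p (e \<otimes>\<^bsub>quot_group H\<^esub> X)"
          using E[OF e(1)] w_mem eQ XQ by auto
        moreover have "a \<in> carrier (quot_group H)" using a AQ by blast
        ultimately show ?thesis using w_mult eQ XQ e(2) by simp
      qed
      then show ?thesis using w_mem[of "a \<otimes>\<^bsub>quot_group H\<^esub> X"] a AQ XQ by blast
    qed
    then show ?thesis using XQ unfolding rcolon_def r_coset_def by auto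
  qed
  then have "rcolon H (emb_carrier H) ?E = rcolon H (emb_carrier H) A"
    using rcolon_antimono[OF sub] by blast
  then show ?thesis using that[OF fin sub] by blast
qed

text \<open>Both halves of the Krull property hold for a monoid cut out of its quotient group by
  integer-valued weights, all but finitely many of which vanish at any given element of it: the powers of a
  multiplier of an ideal have weights bounded below, and the colon of the union of a chain is
  already the colon of one of its members.\<close>

lemma krull_monoid_weights:
  fixes w :: "'i \<Rightarrow> ('a \<times> 'a) set \<Rightarrow> int"
  assumes w_mult: "\<And>p X Y. X \<in> carrier (quot_group H) \<Longrightarrow> Y \<in> carrier (quot_group H) \<Longrightarrow>
      w p (X \<otimes>\<^bsub>quot_group H\<^esub> Y) = w p X + w p Y"
    and w_mem: "\<And>X. X \<in> carrier (quot_group H) \<Longrightarrow> X \<in> emb_carrier H \<longleftrightarrow> (\<forall>p. 0 \<le> w p X)"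
    and w_fin: "\<And>X. X \<in> emb_carrier H \<Longrightarrow> finite {p. w p X \<noteq> 0}"
  shows "krull_monoid H"
  unfolding krull_monoid_def
proof
  have nonneg: "0 \<le> i" if "\<And>n::nat. 0 \<le> int n * i + c" for i c :: int
  proof (rule ccontr)
    assume "\<not> 0 \<le> i"
    \<comment> \<open>For negative \<open>i\<close>, already \<open>n = \<bar>c\<bar> + 1\<close> makes \<open>n i + c\<close> negative.\<close>
    then have "int (nat \<bar>c\<bar> + 1) * i \<le> int (nat \<bar>c\<bar> + 1) * (-1)"
      by (intro mult_left_mono) auto
    then show False using that[of "nat \<bar>c\<bar> + 1"] by auto
  qed
  have w_one: "w p \<one>\<^bsub>quot_group H\<^esub> = 0" for p
    using w_mult[of "\<one>\<^bsub>quot_group H\<^esub>" "\<one>\<^bsub>quot_group H\<^esub>" p] by simp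
  have w_pow: "w p (X [^]\<^bsub>quot_group H\<^esub> n) = int n * w p X"
    if "X \<in> carrier (quot_group H)" for p X and n :: nat
    by (induction n) (use that in \<open>auto simp: w_one w_mult algebra_simps\<close>)
  show "completely_integrally_closed H"
    unfolding completely_integrally_closed_def
  proof (intro allI impI)
    fix A assume "monoid_ideal H A \<and> A \<noteq> {}"
    then have A: "A \<subseteq> emb_carrier H" "A \<noteq> {}"
      "emb_carrier H <#>\<^bsub>quot_group H\<^esub> A = A" "A <#>\<^bsub>quot_group H\<^esub> emb_carrier H = A"
      unfolding monoid_ideal_def fractional_ideal_def by auto
    have AQ: "A \<subseteq> carrier (quot_group H)" using A emb_carrier_subset by auto
    obtain c where c: "c \<in> A" using A by auto
    have cQ: "c \<in> carrier (quot_group H)" using c AQ by auto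
    have "X \<in> emb_carrier H" if X: "X \<in> lcolon H A A" for X
    proof -
      have XQ: "X \<in> carrier (quot_group H)" "\<And>a. a \<in> A \<Longrightarrow> X \<otimes>\<^bsub>quot_group H\<^esub> a \<in> A"
        using X unfolding lcolon_def l_coset_def by auto
      have "X [^]\<^bsub>quot_group H\<^esub> n \<otimes>\<^bsub>quot_group H\<^esub> c \<in> A" for n :: nat
      proof (induction n)
        case 0
        then show ?case using c cQ by simp
      next
        case (Suc n)
        then show ?case using XQ(2)[OF Suc] Q.nat_pow_Suc2[OF XQ(1), of n] XQ(1) cQ
          by (simp add: Q.m_assoc del: Q.nat_pow_Suc)
      qed
      then have "0 \<le> w p (X [^]\<^bsub>quot_group H\<^esub> n \<otimes>\<^bsub>quot_group H\<^esub> c)" for n :: nat and p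
        using w_mem A(1) AQ by blast
      then have "0 \<le> int n * w p X + w p c" for n :: nat and p
        using w_mult w_pow XQ(1) cQ by simp
      then have "0 \<le> w p X" for p by (rule nonneg)
      then show ?thesis using w_mem[OF XQ(1)] by simp
    qed
    moreover have "X \<in> emb_carrier H" if X: "X \<in> rcolon H A A" for X
    proof -
      have XQ: "X \<in> carrier (quot_group H)" "\<And>a. a \<in> A \<Longrightarrow> a \<otimes>\<^bsub>quot_group H\<^esub> X \<in> A"
        using X unfolding rcolon_def r_coset_def by auto
      have "c \<otimes>\<^bsub>quot_group H\<^esub> X [^]\<^bsub>quot_group H\<^esub> n \<in> A" for n :: nat
      proof (induction n)
        case 0
        then show ?case using c cQ by simp
      next
        case (Suc n)
        then show ?case using XQ(2)[OF Suc] XQ(1) cQ by (simp add: Q.m_assoc)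
      qed
      then have "0 \<le> w p (c \<otimes>\<^bsub>quot_group H\<^esub> X [^]\<^bsub>quot_group H\<^esub> n)" for n :: nat and p
        using w_mem A(1) AQ by blast
      then have "0 \<le> int n * w p X + w p c" for n :: nat and p
        using w_mult w_pow XQ(1) cQ by (simp add: add.commute)
      then have "0 \<le> w p X" for p by (rule nonneg)
      then show ?thesis using w_mem[OF XQ(1)] by simp
    qed
    moreover have "emb_carrier H \<subseteq> lcolon H A A"
      using A(3) emb_carrier_subset unfolding lcolon_def l_coset_def set_mult_def by blast
    moreover have "emb_carrier H \<subseteq> rcolon H A A"
      using A(4) emb_carrier_subset unfolding rcolon_def r_coset_def set_mult_def by blast
    ultimately show "lcolon H A A = emb_carrier H \<and> rcolon H A A = emb_carrier H"
      by blast
  qed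
  show "v_noetherian H"
    unfolding v_noetherian_def
  proof (intro allI impI)
    fix A :: "nat \<Rightarrow> ('a \<times> 'a) set set"
    assume A: "\<forall>n. A n \<in> divisorial_ideals H \<and> A n \<subseteq> A (Suc n)"
    have sub: "(\<Union>n. A n) \<subseteq> emb_carrier H"
      using A unfolding divisorial_ideals_def monoid_ideal_def by blast
    have mono: "A m \<subseteq> A n" if "m \<le> n" for m n
      by (rule lift_Suc_mono_le[of A, OF _ that]) (use A in blast)
    obtain E where E: "finite E" "E \<subseteq> (\<Union>n. A n)"
      "rcolon H (emb_carrier H) E = rcolon H (emb_carrier H) (\<Union>n. A n)"
      using finite_subset_same_rcolon[OF w_mult w_mem w_fin sub] .
    have "\<exists>N. E \<subseteq> A N"
      using E(1,2)
    proof (induction E)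
      case (insert x E)
      then obtain N k where "E \<subseteq> A N" "x \<in> A k" by auto
      then have "insert x E \<subseteq> A (max N k)"
        using mono[of N "max N k"] mono[of k "max N k"] by auto
      then show ?case by blast
    qed simp
    then obtain N where N: "E \<subseteq> A N" ..
    \<comment> \<open>The colon of \<open>A n\<close> lies between those of the union and of \<open>E\<close>, which are equal.\<close>
    have "rcolon H (emb_carrier H) (A n) = rcolon H (emb_carrier H) (\<Union>n. A n)" if "N \<le> n" for n
      using rcolon_antimono[of E "A n"] rcolon_antimono[of "A n" "\<Union>n. A n"] E(3) N mono[OF that]
      by blast
    moreover have "A n = lcolon H (emb_carrier H) (rcolon H (emb_carrier H) (A n))" for n
      using A unfolding divisorial_ideals_def v_lr_def by auto
    ultimately show "\<exists>N. \<forall>n\<ge>N. A n = A N"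
      by (metis order_refl)
  qed
qed

text \<open>The left fraction \<open>a\<^sup>-\<^sup>1 b\<close> gets the weight \<open>v p b - v p a\<close>; it lies in \<open>H\<close> exactly if \<open>a\<close> divides
  \<open>b\<close>. Since \<open>v\<close> does not see the order of factors, \<open>a h\<close> is also a left multiple of \<open>a\<close>, which makes
  \<open>H\<close> normalizing.\<close>

lemma normalizing_krull_valuations:
  fixes v :: "'i \<Rightarrow> 'a \<Rightarrow> nat"
  assumes v_mult: "\<And>p a b. a \<in> carrier H \<Longrightarrow> b \<in> carrier H \<Longrightarrow> v p (a \<otimes> b) = v p a + v p b"
    and v_fin: "\<And>a. a \<in> carrier H \<Longrightarrow> finite {p. v p a \<noteq> 0}"
    and v_div: "\<And>a b. a \<in> carrier H \<Longrightarrow> b \<in> carrier H \<Longrightarrow> (\<And>p. v p a \<le> v p b) \<Longrightarrow>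
      a divides b \<and> right_divides H a b"
  shows "normalizing H \<and> krull_monoid H"
proof
  show "normalizing H"
    unfolding normalizing_def
  proof
    fix a assume a: "a \<in> carrier H"
    have "\<exists>k\<in>carrier H. a \<otimes> h = k \<otimes> a" "\<exists>k\<in>carrier H. h \<otimes> a = a \<otimes> k" if "h \<in> carrier H" for h
      using v_div[of a "a \<otimes> h"] v_div[of a "h \<otimes> a"] a that v_mult
      unfolding right_divides_def factor_def by auto
    then show "a <# carrier H = carrier H #> a"
      unfolding l_coset_def r_coset_def by auto
  qed
  define w where "w p X = (THE i. \<exists>a\<in>carrier H. \<exists>b\<in>carrier H.
    X = frac H a b \<and> i = int (v p b) - int (v p a))" for p X
  have w_frac: "w p (frac H a b) = int (v p b) - int (v p a)"
    if ab: "a \<in> carrier H" "b \<in> carrier H" for p a b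
    unfolding w_def
  proof (rule the_equality)
    fix i
    assume "\<exists>c\<in>carrier H. \<exists>d\<in>carrier H. frac H a b = frac H c d \<and> i = int (v p d) - int (v p c)"
    then obtain c d where cd: "c \<in> carrier H" "d \<in> carrier H" "frac H a b = frac H c d"
      "i = int (v p d) - int (v p c)" by blast
    then have "((a, b), (c, d)) \<in> frac_rel H" using frac_eq_iff ab by simp
    then obtain x y where xy: "x \<in> carrier H" "y \<in> carrier H" "x \<otimes> a = y \<otimes> c" "x \<otimes> b = y \<otimes> d"
      by (rule frac_relE)
    have "v p x + v p a = v p y + v p c" "v p x + v p b = v p y + v p d"
      using xy ab cd by (metis v_mult)+
    then show "i = int (v p b) - int (v p a)" using cd(4) by linarith
  qed (use ab in blast)
  have v_one: "v p \<one> = 0" for p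
    using v_mult[of \<one> \<one> p] by simp
  show "krull_monoid H"
  proof (rule krull_monoid_weights[of w])
    fix p X Y assume "X \<in> carrier (quot_group H)" "Y \<in> carrier (quot_group H)"
    then obtain a b c where "a \<in> carrier H" "b \<in> carrier H" "c \<in> carrier H"
      "X = frac H a b" "Y = frac H b c" by (rule quot_group_chain)
    then show "w p (X \<otimes>\<^bsub>quot_group H\<^esub> Y) = w p X + w p Y"
      by (simp add: frac_mult_chain w_frac)
  next
    fix X assume "X \<in> carrier (quot_group H)"
    then obtain a b where ab: "a \<in> carrier H" "b \<in> carrier H" "X = frac H a b"
      by (rule quot_groupE)
    show "X \<in> emb_carrier H \<longleftrightarrow> (\<forall>p. 0 \<le> w p X)"
    proof
      assume "X \<in> emb_carrier H"
      then show "\<forall>p. 0 \<le> w p X"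
        unfolding emb_carrier_def quot_emb_def by (auto simp: w_frac v_one)
    next
      assume "\<forall>p. 0 \<le> w p X"
      then have "a divides b" using v_div[of a b] ab w_frac by simp
      then obtain c where c: "c \<in> carrier H" "b = a \<otimes> c" by (auto simp: factor_def)
      then have "X = frac H \<one> c" using frac_cancel[of a \<one> c] ab by simp
      then show "X \<in> emb_carrier H" unfolding emb_carrier_def quot_emb_def using c by auto
    qed
  next
    fix X assume "X \<in> emb_carrier H"
    then obtain a where a: "a \<in> carrier H" "X = frac H \<one> a"
      unfolding emb_carrier_def quot_emb_def by auto
    then show "finite {p. w p X \<noteq> 0}" using v_fin by (simp add: w_frac v_one)
  qed
qed

lemma normalizing_krull_divisor_hom:
  fixes D :: "('d, 'e) monoid_scheme"
  assumes "free_abelian_monoid D P" and \<phi>: "divisor_hom H D \<phi>"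
  shows "normalizing H \<and> krull_monoid H"
proof -
  interpret D: comm_monoid D using assms(1) by (simp add: free_abelian_monoid_def)
  obtain e :: "'d \<Rightarrow> 'd \<Rightarrow> nat" where
    e: "\<forall>x\<in>carrier D. finite {p. e x p \<noteq> 0}"
      "\<forall>x\<in>carrier D. \<forall>y\<in>carrier D. \<forall>p. e (x \<otimes>\<^bsub>D\<^esub> y) p = e x p + e y p"
      "\<forall>x\<in>carrier D. \<forall>y\<in>carrier D. (\<forall>p. e x p \<le> e y p) \<longrightarrow> x divides\<^bsub>D\<^esub> y"
    using free_abelian_monoid_exponents[OF assms(1)] by blast
  have hom: "\<phi> \<in> hom H D" using \<phi> by (simp add: divisor_hom_def)
  show ?thesis
  proof (rule normalizing_krull_valuations[of "\<lambda>p a. e (\<phi> a) p"])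
    fix a b assume ab: "a \<in> carrier H" "b \<in> carrier H"
    have car: "\<phi> a \<in> carrier D" "\<phi> b \<in> carrier D" using hom ab by (auto simp: hom_def)
    show "e (\<phi> (a \<otimes> b)) p = e (\<phi> a) p + e (\<phi> b) p" for p
      using e(2) car ab hom by (simp add: hom_mult)
    assume "\<And>p. e (\<phi> a) p \<le> e (\<phi> b) p"
    then have "\<phi> a divides\<^bsub>D\<^esub> \<phi> b" using e(3) car by blast
    moreover from this have "right_divides D (\<phi> a) (\<phi> b)"
      unfolding right_divides_def factor_def using car D.m_comm by auto
    ultimately show "a divides b \<and> right_divides H a b"
      using \<phi> ab by (simp add: divisor_hom_def)
  qed (use e(1) hom in \<open>auto simp: hom_def\<close>)
qed

lemma normalizing_krull_divisor_theory:
  assumes "divisor_theory H D \<phi>"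
  shows "normalizing H \<and> krull_monoid H"
  using assms normalizing_krull_divisor_hom unfolding divisor_theory_def by blast

end

section \<open>The monoid of v-ideals\<close>

text \<open>The order-theoretic part takes place in a group \<open>G\<close> with a submonoid \<open>M\<close> invariant under
  conjugation, later the quotient group and the copy of \<open>H\<close> in it. The \<open>polar\<close> of \<open>A\<close> is the colon
  \<open>(M :\<^sub>r A)\<close>, and by \<open>mult_mem_swap\<close> also \<open>(M :\<^sub>l A)\<close>.\<close>

locale normal_submonoid = group G for G (structure) +
  fixes M :: "'a set"
  assumes M_subset: "M \<subseteq> carrier G"
    and M_one: "\<one> \<in> M"
    and M_mult: "\<lbrakk>x \<in> M; y \<in> M\<rbrakk> \<Longrightarrow> x \<otimes> y \<in> M"
    and M_conj: "\<lbrakk>x \<in> M; g \<in> carrier G\<rbrakk> \<Longrightarrow> g \<otimes> x \<otimes> inv g \<in> M"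
begin

definition polar :: "'a set \<Rightarrow> 'a set" where
  "polar A = {x \<in> carrier G. \<forall>a\<in>A. a \<otimes> x \<in> M}"

definition v_closure :: "'a set \<Rightarrow> 'a set" where
  "v_closure A = polar (polar A)"

definition v_prod :: "'a set \<Rightarrow> 'a set \<Rightarrow> 'a set" where
  "v_prod A B = v_closure (A <#> B)"

text \<open>The empty set is left out: it can be divisorial, but then it is not \<open>v\<close>-invertible.\<close>

definition v_ideals :: "'a set set" where
  "v_ideals = {A. A \<subseteq> M \<and> v_closure A = A \<and> A \<noteq> {}}"

definition maximal_v_ideals :: "'a set set" where
  "maximal_v_ideals = {P \<in> v_ideals. P \<noteq> M \<and> (\<forall>A\<in>v_ideals. P \<subseteq> A \<longrightarrow> A = P \<or> A = M)}"

text \<open>\<open>y x\<close> is the conjugate of \<open>x y\<close> by \<open>y\<close>. The swap is what makes left and right colons into \<open>M\<close> agree.\<close>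

lemma mult_mem_swap:
  assumes "x \<in> carrier G" "y \<in> carrier G" "x \<otimes> y \<in> M"
  shows "y \<otimes> x \<in> M"
proof -
  have "y \<otimes> (x \<otimes> y) \<otimes> inv y \<in> M" by (rule M_conj) (use assms in auto)
  then show ?thesis using assms by (simp add: m_assoc)
qed

lemma polarI: "x \<in> carrier G \<Longrightarrow> (\<And>a. a \<in> A \<Longrightarrow> a \<otimes> x \<in> M) \<Longrightarrow> x \<in> polar A"
  by (simp add: polar_def)

lemma polarD: "x \<in> polar A \<Longrightarrow> a \<in> A \<Longrightarrow> a \<otimes> x \<in> M"
  by (simp add: polar_def)

lemma polar_subset: "polar A \<subseteq> carrier G"
  by (auto simp: polar_def)

lemma polarD': "x \<in> polar A \<Longrightarrow> a \<in> A \<Longrightarrow> A \<subseteq> carrier G \<Longrightarrow> x \<otimes> a \<in> M"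
  using mult_mem_swap polarD polar_subset by (meson subsetD)

lemma polar_antimono: "A \<subseteq> B \<Longrightarrow> polar B \<subseteq> polar A"
  by (auto simp: polar_def)

lemma v_closure_subset: "v_closure A \<subseteq> carrier G"
  by (simp add: v_closure_def polar_subset)

lemma subset_v_closure: "A \<subseteq> carrier G \<Longrightarrow> A \<subseteq> v_closure A"
  unfolding v_closure_def by (auto intro!: polarI elim: polarD')

lemma v_closure_mono: "A \<subseteq> B \<Longrightarrow> v_closure A \<subseteq> v_closure B"
  by (simp add: v_closure_def polar_antimono)

lemma polar_v_closure: "A \<subseteq> carrier G \<Longrightarrow> polar (v_closure A) = polar A"
  using polar_antimono[OF subset_v_closure[of A]] subset_v_closure[OF polar_subset[of A]]
  by (auto simp: v_closure_def)

lemma v_closure_idem: "A \<subseteq> carrier G \<Longrightarrow> v_closure (v_closure A) = v_closure A"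
  by (metis polar_v_closure v_closure_def)

lemma polar_M: "polar M = M"
proof
  show "polar M \<subseteq> M" using polarD[OF _ M_one] polar_subset by force
  show "M \<subseteq> polar M" using M_subset M_mult by (auto intro!: polarI)
qed

lemma v_closure_M: "v_closure M = M"
  by (simp add: v_closure_def polar_M)

lemma one_polar: "A \<subseteq> M \<Longrightarrow> \<one> \<in> polar A"
  using M_subset by (intro polarI) (auto simp: subset_iff)

lemma polar_mult_left: "\<lbrakk>A \<subseteq> carrier G; x \<in> polar A; m \<in> M\<rbrakk> \<Longrightarrow> m \<otimes> x \<in> polar A"
proof (rule polarI)
  assume A: "A \<subseteq> carrier G" and x: "x \<in> polar A" and m: "m \<in> M"
  have car: "x \<in> carrier G" "m \<in> carrier G" using x m polar_subset M_subset by auto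
  then show "m \<otimes> x \<in> carrier G" by simp
  fix a assume a: "a \<in> A"
  then have "m \<otimes> (x \<otimes> a) \<in> M" using M_mult m polarD' x A by blast
  moreover have aG: "a \<in> carrier G" using a A by blast
  ultimately have "(m \<otimes> x) \<otimes> a \<in> M" using car by (simp add: m_assoc)
  then show "a \<otimes> (m \<otimes> x) \<in> M" using mult_mem_swap car aG by blast
qed

lemma polar_mult_right: "\<lbrakk>A \<subseteq> carrier G; x \<in> polar A; m \<in> M\<rbrakk> \<Longrightarrow> x \<otimes> m \<in> polar A"
proof (rule polarI)
  assume A: "A \<subseteq> carrier G" and x: "x \<in> polar A" and m: "m \<in> M"
  have car: "x \<in> carrier G" "m \<in> carrier G" using x m polar_subset M_subset by auto
  then show "x \<otimes> m \<in> carrier G" by simp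
  fix a assume a: "a \<in> A"
  then have "(a \<otimes> x) \<otimes> m \<in> M" using M_mult m polarD x by blast
  moreover have aG: "a \<in> carrier G" using a A by blast
  ultimately show "a \<otimes> (x \<otimes> m) \<in> M" using car by (simp add: m_assoc)
qed

text \<open>The polar of \<open>g\<close> contains \<open>g\<^sup>-\<^sup>1\<close>, which already forces \<open>y \<in> g M\<close> for every \<open>y\<close> in the second
  polar.\<close>

lemma v_closure_singleton:
  assumes g: "g \<in> carrier G"
  shows "v_closure {g} = g <# M"
proof
  have inv: "inv g \<in> polar {g}" using g M_one by (auto intro!: polarI)
  show "v_closure {g} \<subseteq> g <# M"
  proof
    fix y assume y: "y \<in> v_closure {g}"
    then have yG: "y \<in> carrier G" using v_closure_subset by blast
    have "inv g \<otimes> y \<in> M" using polarD[of y "polar {g}" "inv g"] y inv by (simp add: v_closure_def)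
    moreover have "y = g \<otimes> (inv g \<otimes> y)" using g yG by (simp add: m_assoc[symmetric])
    ultimately show "y \<in> g <# M" unfolding l_coset_def by blast
  qed
  have "g \<in> v_closure {g}" using subset_v_closure[of "{g}"] g by simp
  then show "g <# M \<subseteq> v_closure {g}"
    using polar_mult_right[OF polar_subset[of "{g}"]] unfolding l_coset_def v_closure_def by auto
qed

lemma set_mult_memI: "a \<in> A \<Longrightarrow> b \<in> B \<Longrightarrow> a \<otimes> b \<in> A <#> B"
  by (auto simp: set_mult_def)

text \<open>The polar of a product only depends on the polar of either factor, hence only on its
  \<open>v\<close>-closure; this is what makes \<open>v\<close>-multiplication associative.\<close>

lemma polar_set_mult_right:
  assumes "A \<subseteq> carrier G" "B \<subseteq> carrier G"
  shows "polar (A <#> B) = {x \<in> carrier G. \<forall>b\<in>B. b \<otimes> x \<in> polar A}"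
  unfolding polar_def set_mult_def using assms by (auto simp: m_assoc subset_iff)

lemma polar_set_mult_left:
  assumes A: "A \<subseteq> carrier G" and B: "B \<subseteq> carrier G"
  shows "polar (A <#> B) = {x \<in> carrier G. \<forall>a\<in>A. x \<otimes> a \<in> polar B}"
proof -
  have "a \<otimes> b \<otimes> x \<in> M \<longleftrightarrow> b \<otimes> (x \<otimes> a) \<in> M"
    if "a \<in> carrier G" "b \<in> carrier G" "x \<in> carrier G" for a b x
    using mult_mem_swap[of a "b \<otimes> x"] mult_mem_swap[of "b \<otimes> x" a] that by (auto simp: m_assoc)
  then show ?thesis
    unfolding polar_def set_mult_def using A B by (auto simp: subset_iff)
qed

lemma v_prod_v_closure_left:
  assumes "A \<subseteq> carrier G" "B \<subseteq> carrier G"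
  shows "v_prod (v_closure A) B = v_prod A B"
  using assms by (simp add: v_prod_def v_closure_def[of "_ <#> _"] polar_set_mult_right
      v_closure_subset polar_v_closure)

lemma v_prod_v_closure_right:
  assumes "A \<subseteq> carrier G" "B \<subseteq> carrier G"
  shows "v_prod A (v_closure B) = v_prod A B"
  using assms by (simp add: v_prod_def v_closure_def[of "_ <#> _"] polar_set_mult_left
      v_closure_subset polar_v_closure)

lemma v_prod_assoc:
  assumes "A \<subseteq> carrier G" "B \<subseteq> carrier G" "C \<subseteq> carrier G"
  shows "v_prod (v_prod A B) C = v_prod A (v_prod B C)"
proof -
  have "A <#> B \<subseteq> carrier G" "B <#> C \<subseteq> carrier G" using assms set_mult_closed by auto
  then have "v_prod (v_prod A B) C = v_closure (A <#> B <#> C)"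
    "v_prod A (v_prod B C) = v_closure (A <#> (B <#> C))"
    using v_prod_v_closure_left[of "A <#> B" C] v_prod_v_closure_right[of A "B <#> C"] assms
    by (simp_all add: v_prod_def)
  then show ?thesis using assms set_mult_assoc by simp
qed

lemma v_prod_mono: "A \<subseteq> A' \<Longrightarrow> B \<subseteq> B' \<Longrightarrow> v_prod A B \<subseteq> v_prod A' B'"
  unfolding v_prod_def by (intro v_closure_mono) (auto simp: set_mult_def)

lemma v_prod_M_left: "A \<subseteq> carrier G \<Longrightarrow> v_prod M A = v_closure A"
  using polar_set_mult_right[of M A] M_subset
  by (simp add: v_prod_def v_closure_def polar_M polar_def[of A])

lemma v_prod_M_right: "A \<subseteq> carrier G \<Longrightarrow> v_prod A M = v_closure A"
proof -
  assume A: "A \<subseteq> carrier G"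
  have "x \<otimes> a \<in> M \<longleftrightarrow> a \<otimes> x \<in> M" if "x \<in> carrier G" "a \<in> A" for x a
    using mult_mem_swap[of x a] mult_mem_swap[of a x] that A by auto
  then have "{x \<in> carrier G. \<forall>a\<in>A. x \<otimes> a \<in> M} = polar A"
    unfolding polar_def by blast
  then have "polar (A <#> M) = polar A"
    using polar_set_mult_left[of A M] M_subset A by (simp add: polar_M)
  then show ?thesis by (simp add: v_prod_def v_closure_def)
qed

lemma v_idealsD:
  assumes "A \<in> v_ideals"
  shows "A \<subseteq> M" "A \<subseteq> carrier G" "v_closure A = A" "A \<noteq> {}"
  using assms M_subset by (auto simp: v_ideals_def)

lemma v_ideal_mult:
  assumes "A \<in> v_ideals" "a \<in> A" "m \<in> M"
  shows "m \<otimes> a \<in> A" "a \<otimes> m \<in> A"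
  using polar_mult_left[of "polar A" a m] polar_mult_right[of "polar A" a m] assms
    v_idealsD(3)[OF assms(1)] polar_subset by (auto simp: v_closure_def)

lemma v_closure_v_ideal:
  assumes "A \<subseteq> M" "A \<noteq> {}"
  shows "v_closure A \<in> v_ideals"
proof -
  have "A \<subseteq> carrier G" using assms M_subset by auto
  then show ?thesis
    using assms v_closure_mono[of A M] v_closure_M subset_v_closure[of A] v_closure_idem[of A]
    by (auto simp: v_ideals_def)
qed

lemma v_closure_least: "A \<subseteq> B \<Longrightarrow> B \<in> v_ideals \<Longrightarrow> v_closure A \<subseteq> B"
  using v_closure_mono[of A B] v_idealsD(3) by auto

lemma M_v_ideal: "M \<in> v_ideals"
  using v_closure_M M_one by (auto simp: v_ideals_def)

lemma v_prod_v_ideal: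
  assumes "A \<in> v_ideals" "B \<in> v_ideals"
  shows "v_prod A B \<in> v_ideals"
  unfolding v_prod_def
proof (rule v_closure_v_ideal)
  show "A <#> B \<subseteq> M" using v_idealsD(1) assms M_mult by (force simp: set_mult_def)
  show "A <#> B \<noteq> {}" using v_idealsD(4) assms by (force simp: set_mult_def)
qed

lemma v_prod_subset_left: "A \<in> v_ideals \<Longrightarrow> B \<in> v_ideals \<Longrightarrow> v_prod A B \<subseteq> A"
  using v_prod_mono[of A A B M] v_prod_M_right[of A] v_idealsD by auto

lemma v_prod_subset_right: "A \<in> v_ideals \<Longrightarrow> B \<in> v_ideals \<Longrightarrow> v_prod A B \<subseteq> B"
  using v_prod_mono[of A M B B] v_prod_M_left[of B] v_idealsD by auto

lemma maximal_v_idealsD: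
  assumes "P \<in> maximal_v_ideals"
  shows "P \<in> v_ideals" "P \<noteq> M" "\<And>A. A \<in> v_ideals \<Longrightarrow> P \<subseteq> A \<Longrightarrow> A \<noteq> M \<Longrightarrow> A = P"
  using assms by (auto simp: maximal_v_ideals_def)

text \<open>If \<open>P\<close> does not contain \<open>A\<close>, then by maximality \<open>A\<close> and \<open>P\<close> together generate \<open>M\<close>. Multiplying by
  \<open>B\<close> from the right lands in \<open>P\<close>, and \<open>M B\<close> contains \<open>B\<close>. The argument is run on polars: if \<open>x\<close> is in
  the polar of \<open>P\<close>, then \<open>b x\<close> is in the polar of \<open>A \<union> P\<close>, which is \<open>M\<close>.\<close>

lemma maximal_v_ideal_prime:
  assumes P: "P \<in> maximal_v_ideals" and A: "A \<in> v_ideals" and B: "B \<in> v_ideals"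
    and AB: "v_prod A B \<subseteq> P" and nA: "\<not> A \<subseteq> P"
  shows "B \<subseteq> P"
proof -
  note PV = maximal_v_idealsD(1)[OF P]
  let ?J = "v_closure (A \<union> P)"
  have sub: "A \<union> P \<subseteq> M" "A \<union> P \<subseteq> carrier G" using v_idealsD A PV by auto
  have "A \<union> P \<noteq> {}" using v_idealsD(4)[OF A] by auto
  then have J: "?J \<in> v_ideals" using v_closure_v_ideal sub by blast
  have "A \<union> P \<subseteq> ?J" using subset_v_closure sub by blast
  then have "?J = M" using maximal_v_idealsD(3)[OF P J] nA by blast
  then have polar_AP: "polar (A \<union> P) = M" using polar_v_closure[OF sub(2)] polar_M by simp
  have "b \<otimes> x \<in> M" if x: "x \<in> polar P" and b: "b \<in> B" for x b
  proof -
    have car: "x \<in> carrier G" "b \<in> carrier G" "b \<in> M"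
      using x b polar_subset v_idealsD[OF B] by auto
    have "b \<otimes> x \<in> polar (A \<union> P)"
    proof (rule polarI)
      fix a assume a: "a \<in> A \<union> P"
      have "A <#> B \<subseteq> P"
        using AB subset_v_closure[of "A <#> B"] set_mult_closed[of A B] v_idealsD(2) A B
        by (auto simp: v_prod_def)
      then have "a \<otimes> b \<in> P"
        using a b car(3) v_ideal_mult(2)[OF PV] set_mult_memI[of a A b B] by auto
      then have "a \<otimes> b \<otimes> x \<in> M" using polarD[OF x] by blast
      moreover have "a \<in> carrier G" using a sub by blast
      ultimately show "a \<otimes> (b \<otimes> x) \<in> M" using car by (simp add: m_assoc)
    qed (use car in simp)
    then show ?thesis using polar_AP by simp
  qed
  then have "polar P \<subseteq> polar B" using polar_subset by (auto intro!: polarI)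
  then show ?thesis
    using polar_antimono v_idealsD(3)[OF PV] v_idealsD(3)[OF B] by (metis v_closure_def)
qed

lemma maximal_v_ideals_incomparable:
  "P \<in> maximal_v_ideals \<Longrightarrow> Q \<in> maximal_v_ideals \<Longrightarrow> P \<subseteq> Q \<Longrightarrow> P = Q"
  using maximal_v_idealsD(1,2)[of Q] maximal_v_idealsD(3)[of P Q] by auto

definition v_ideal_monoid :: "'a set monoid" where
  "v_ideal_monoid = \<lparr>carrier = v_ideals, monoid.mult = v_prod, one = M\<rparr>"

lemma v_ideal_monoid_simps:
  "carrier v_ideal_monoid = v_ideals" "A \<otimes>\<^bsub>v_ideal_monoid\<^esub> B = v_prod A B" "\<one>\<^bsub>v_ideal_monoid\<^esub> = M"
  by (simp_all add: v_ideal_monoid_def)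

end

text \<open>The assumptions are complete integral closedness for left and right multipliers of ideals, and
  the ascending chain condition on nonempty \<open>v\<close>-ideals.\<close>

locale krull_submonoid = normal_submonoid +
  assumes colon_self_left: "\<lbrakk>A \<subseteq> M; A \<noteq> {}; \<And>m a. m \<in> M \<Longrightarrow> a \<in> A \<Longrightarrow> m \<otimes> a \<in> A;
      \<And>m a. m \<in> M \<Longrightarrow> a \<in> A \<Longrightarrow> a \<otimes> m \<in> A; x \<in> carrier G; \<And>a. a \<in> A \<Longrightarrow> x \<otimes> a \<in> A\<rbrakk> \<Longrightarrow> x \<in> M"
    and colon_self_right: "\<lbrakk>A \<subseteq> M; A \<noteq> {}; \<And>m a. m \<in> M \<Longrightarrow> a \<in> A \<Longrightarrow> m \<otimes> a \<in> A;
      \<And>m a. m \<in> M \<Longrightarrow> a \<in> A \<Longrightarrow> a \<otimes> m \<in> A; x \<in> carrier G; \<And>a. a \<in> A \<Longrightarrow> a \<otimes> x \<in> A\<rbrakk> \<Longrightarrow> x \<in> M"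
    and acc: "\<And>A :: nat \<Rightarrow> 'a set. (\<And>n. A n \<in> v_ideals \<and> A n \<subseteq> A (Suc n)) \<Longrightarrow>
      \<exists>N. \<forall>n\<ge>N. A n = A N"
begin

text \<open>A multiplier \<open>x\<close> with \<open>x A A' \<subseteq> M\<close>, for the polar \<open>A'\<close> of \<open>A\<close>, satisfies \<open>x A \<subseteq> A'' = A\<close>, so it lies
  in \<open>M\<close> by complete integral closedness. Hence \<open>A A'\<close> has the same polar as \<open>M\<close>: the
  polar is a right inverse, and by the mirror image of this argument also a left inverse.\<close>

lemma v_prod_polar_right:
  assumes A: "A \<in> v_ideals"
  shows "v_prod A (polar A) = M"
proof -
  note AV = v_idealsD[OF A]
  have "polar (A <#> polar A) = {x \<in> carrier G. \<forall>a\<in>A. x \<otimes> a \<in> A}"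
    using polar_set_mult_left[OF AV(2) polar_subset[of A]] AV(3) by (simp add: v_closure_def)
  also have "\<dots> = M"
  proof
    show "{x \<in> carrier G. \<forall>a\<in>A. x \<otimes> a \<in> A} \<subseteq> M"
      using colon_self_left[OF AV(1,4)] v_ideal_mult[OF A] by blast
    show "M \<subseteq> {x \<in> carrier G. \<forall>a\<in>A. x \<otimes> a \<in> A}"
      using v_ideal_mult(1)[OF A] M_subset by blast
  qed
  finally show ?thesis by (simp add: v_prod_def v_closure_def polar_M)
qed

lemma v_prod_polar_left:
  assumes A: "A \<in> v_ideals"
  shows "v_prod (polar A) A = M"
proof -
  note AV = v_idealsD[OF A]
  have "polar (polar A <#> A) = {x \<in> carrier G. \<forall>a\<in>A. a \<otimes> x \<in> A}"
    using polar_set_mult_right[OF polar_subset[of A] AV(2)] AV(3) by (simp add: v_closure_def)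
  also have "\<dots> = M"
  proof
    show "{x \<in> carrier G. \<forall>a\<in>A. a \<otimes> x \<in> A} \<subseteq> M"
      using colon_self_right[OF AV(1,4)] v_ideal_mult[OF A] by blast
    show "M \<subseteq> {x \<in> carrier G. \<forall>a\<in>A. a \<otimes> x \<in> A}"
      using v_ideal_mult(2)[OF A] M_subset by blast
  qed
  finally show ?thesis by (simp add: v_prod_def v_closure_def polar_M)
qed

lemma v_prod_cancel_left:
  assumes A: "A \<in> v_ideals" and B: "B \<in> v_ideals"
  shows "v_prod (polar A) (v_prod A B) = B"
  using v_prod_assoc[OF polar_subset v_idealsD(2)[OF A] v_idealsD(2)[OF B], of A]
    v_prod_polar_left[OF A] v_prod_M_left[of B] v_idealsD[OF B] by simp

text \<open>To contain is to divide: the cofactor is \<open>B' \<cdot>\<^sub>v A\<close> for the polar \<open>B'\<close> of \<open>B\<close>, and it lies in \<open>M\<close>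
  because \<open>B' A \<subseteq> B' B \<subseteq> M\<close>.\<close>

lemma subset_imp_factor:
  assumes A: "A \<in> v_ideals" and B: "B \<in> v_ideals" and sub: "A \<subseteq> B"
  obtains C where "C \<in> v_ideals" "A = v_prod B C"
proof
  let ?C = "v_prod (polar B) A"
  note AV = v_idealsD[OF A] and BV = v_idealsD[OF B]
  show "?C \<in> v_ideals"
    unfolding v_prod_def
  proof (rule v_closure_v_ideal)
    show "polar B <#> A \<subseteq> M"
      using sub polarD'[of _ B] BV(2) by (auto simp: set_mult_def)
    show "polar B <#> A \<noteq> {}"
      using one_polar[OF BV(1)] AV(4) by (auto simp: set_mult_def)
  qed
  show "A = v_prod B ?C"
    using v_prod_assoc[OF BV(2) polar_subset AV(2), of B] v_prod_polar_right[OF B]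
      v_prod_M_left[OF AV(2)] AV(3) by simp
qed

lemma v_ideals_wf: "wf {(B, A). A \<in> v_ideals \<and> B \<in> v_ideals \<and> A \<subset> B}"
  unfolding wf_iff_no_infinite_down_chain
proof
  assume "\<exists>f. \<forall>i. (f (Suc i), f i) \<in> {(B, A). A \<in> v_ideals \<and> B \<in> v_ideals \<and> A \<subset> B}"
  then obtain f :: "nat \<Rightarrow> 'a set"
    where "\<forall>i. (f (Suc i), f i) \<in> {(B, A). A \<in> v_ideals \<and> B \<in> v_ideals \<and> A \<subset> B}" ..
  then have f: "f i \<in> v_ideals \<and> f i \<subset> f (Suc i)" for i by blast
  have "\<exists>N. \<forall>n\<ge>N. f n = f N" by (rule acc) (use f in auto)
  then obtain N where "\<forall>n\<ge>N. f n = f N" ..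
  then have "f (Suc N) = f N" using le_SucI[OF order_refl] by blast
  then show False using f[of N] by simp
qed

lemma v_ideals_maximal:
  assumes "S \<subseteq> v_ideals" "A \<in> S"
  shows "\<exists>B\<in>S. \<forall>C\<in>S. B \<subseteq> C \<longrightarrow> C = B"
proof (rule wfE_min[OF v_ideals_wf assms(2)])
  fix B assume B: "B \<in> S"
    and min: "\<And>C. (C, B) \<in> {(B, A). A \<in> v_ideals \<and> B \<in> v_ideals \<and> A \<subset> B} \<Longrightarrow> C \<notin> S"
  have "C = B" if "C \<in> S" "B \<subseteq> C" for C
  proof (rule ccontr)
    assume "C \<noteq> B"
    then have "(C, B) \<in> {(B, A). A \<in> v_ideals \<and> B \<in> v_ideals \<and> A \<subset> B}"
      using that B assms(1) by auto
    then show False using min that(1) by simp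
  qed
  then show ?thesis using B by auto
qed

text \<open>This is where commutativity originates: \<open>P \<cdot>\<^sub>v Q\<close> is contained in \<open>Q\<close>, so it has the form
  \<open>Q \<cdot>\<^sub>v C\<close>, and primality of \<open>P\<close> gives \<open>C \<subseteq> P\<close>.\<close>

lemma maximal_v_ideals_commute:
  assumes P: "P \<in> maximal_v_ideals" and Q: "Q \<in> maximal_v_ideals"
  shows "v_prod P Q = v_prod Q P"
proof -
  have sub: "v_prod P Q \<subseteq> v_prod Q P"
    if P: "P \<in> maximal_v_ideals" and Q: "Q \<in> maximal_v_ideals" and ne: "P \<noteq> Q" for P Q
  proof -
    note PV = maximal_v_idealsD(1)[OF P] and QV = maximal_v_idealsD(1)[OF Q]
    obtain C where C: "C \<in> v_ideals" "v_prod P Q = v_prod Q C"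
      using subset_imp_factor[OF v_prod_v_ideal[OF PV QV] QV v_prod_subset_right[OF PV QV]] .
    have "v_prod Q C \<subseteq> P" using v_prod_subset_left[OF PV QV] C(2) by simp
    moreover have "\<not> Q \<subseteq> P" using maximal_v_ideals_incomparable P Q ne by blast
    ultimately have "C \<subseteq> P" using maximal_v_ideal_prime[OF P QV C(1)] by blast
    then show ?thesis using C(2) v_prod_mono[of Q Q C P] by simp
  qed
  show ?thesis using sub[OF P Q] sub[OF Q P] by (cases "P = Q") auto
qed

text \<open>Noetherian induction: splitting off a maximal \<open>v\<close>-ideal \<open>P\<close> above \<open>A\<close> leaves a cofactor that is
  strictly larger than \<open>A\<close>, for otherwise \<open>P \<cdot>\<^sub>v A = A\<close> and cancelling \<open>A\<close> gives \<open>P = M\<close>.\<close>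

lemma v_ideal_factorization:
  assumes "A \<in> v_ideals"
  shows "\<exists>Ps. set Ps \<subseteq> maximal_v_ideals \<and> A = foldr v_prod Ps M"
  using v_ideals_wf assms
proof (induction A rule: wf_induct_rule)
  case (less A)
  note AV = v_idealsD[OF less.prems]
  show ?case
  proof (cases "A = M")
    case True
    then show ?thesis by (intro exI[of _ "[]"]) simp
  next
    case False
    let ?S = "{B \<in> v_ideals. A \<subseteq> B \<and> B \<noteq> M}"
    obtain P where P: "P \<in> ?S" and max: "\<forall>C\<in>?S. P \<subseteq> C \<longrightarrow> C = P"
      using v_ideals_maximal[of ?S A] less.prems False by auto
    then have Pmax: "P \<in> maximal_v_ideals" unfolding maximal_v_ideals_def by blast
    have PV: "P \<in> v_ideals" "A \<subseteq> P" "P \<noteq> M" using P by auto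
    obtain C where C: "C \<in> v_ideals" "A = v_prod P C"
      using subset_imp_factor[OF less.prems PV(1,2)] .
    have "A \<subseteq> C" using v_prod_subset_right[OF PV(1) C(1)] C(2) by simp
    moreover have "A \<noteq> C"
    proof
      assume "A = C"
      then have "v_prod P A = A" using C(2) by simp
      then have "v_prod P (v_prod A (polar A)) = v_prod A (polar A)"
        using v_prod_assoc[OF v_idealsD(2)[OF PV(1)] AV(2) polar_subset[of A]] by simp
      then show False
        using v_prod_polar_right[OF less.prems] v_prod_M_right[of P] v_idealsD[OF PV(1)] PV(3) by simp
    qed
    ultimately obtain Ps where "set Ps \<subseteq> maximal_v_ideals" "C = foldr v_prod Ps M"
      using less.IH[of C] less.prems C(1) by blast
    then show ?thesis using Pmax C(2) by (intro exI[of _ "P # Ps"]) simp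
  qed
qed

lemma foldr_v_prod_v_ideal: "set Ps \<subseteq> v_ideals \<Longrightarrow> foldr v_prod Ps M \<in> v_ideals"
  by (induction Ps) (auto simp: M_v_ideal v_prod_v_ideal)

lemma commute_foldr:
  assumes "\<And>P. P \<in> set Ps \<Longrightarrow> v_prod A P = v_prod P A" "A \<in> v_ideals" "set Ps \<subseteq> v_ideals"
  shows "v_prod A (foldr v_prod Ps M) = v_prod (foldr v_prod Ps M) A"
  using assms
proof (induction Ps)
  case Nil
  then show ?case using v_prod_M_left[of A] v_prod_M_right[of A] v_idealsD by simp
next
  case (Cons P Ps)
  let ?C = "foldr v_prod Ps M"
  have car: "A \<subseteq> carrier G" "P \<subseteq> carrier G" "?C \<subseteq> carrier G"
    using Cons.prems v_idealsD(2) foldr_v_prod_v_ideal[of Ps] by auto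
  have "v_prod A (v_prod P ?C) = v_prod (v_prod P A) ?C"
    using Cons.prems(1)[of P] v_prod_assoc[OF car] by simp
  also have "\<dots> = v_prod P (v_prod ?C A)"
    using Cons v_prod_assoc[OF car(2,1,3)] by simp
  also have "\<dots> = v_prod (v_prod P ?C) A"
    using v_prod_assoc[OF car(2,3,1)] by simp
  finally show ?case by simp
qed

lemma v_prod_commute:
  assumes A: "A \<in> v_ideals" and B: "B \<in> v_ideals"
  shows "v_prod A B = v_prod B A"
proof -
  have maxV: "maximal_v_ideals \<subseteq> v_ideals" by (auto simp: maximal_v_ideals_def)
  \<comment> \<open>First with one factor maximal, then in general: each step factors \<open>B\<close> into maximal ideals.\<close>
  have 1: "v_prod P B = v_prod B P" if P: "P \<in> maximal_v_ideals" and B: "B \<in> v_ideals" for P B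
    using v_ideal_factorization[OF B] commute_foldr[of _ P] maximal_v_ideals_commute[OF P] P maxV
    by (metis subset_eq)
  then show ?thesis
    using v_ideal_factorization[OF B] commute_foldr[of _ A] A maxV by (metis subset_eq)
qed

lemma v_ideal_monoid_comm_cancel: "comm_monoid_cancel v_ideal_monoid"
proof -
  have comm: "comm_monoid v_ideal_monoid"
  proof (rule comm_monoidI, unfold v_ideal_monoid_simps)
    show "v_prod A B \<in> v_ideals" if "A \<in> v_ideals" "B \<in> v_ideals" for A B
      using that by (rule v_prod_v_ideal)
    show "v_prod (v_prod A B) C = v_prod A (v_prod B C)"
      if "A \<in> v_ideals" "B \<in> v_ideals" "C \<in> v_ideals" for A B C
      by (rule v_prod_assoc) (use v_idealsD(2) that in auto)
    show "v_prod M A = A" if "A \<in> v_ideals" for A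
      using v_prod_M_left[OF v_idealsD(2)[OF that]] v_idealsD(3)[OF that] by simp
    show "v_prod A B = v_prod B A" if "A \<in> v_ideals" "B \<in> v_ideals" for A B
      using that by (rule v_prod_commute)
  qed (rule M_v_ideal)
  have cancel: "A = B"
    if "v_prod A C = v_prod B C" and A: "A \<in> v_ideals" and B: "B \<in> v_ideals" and C: "C \<in> v_ideals"
    for A B C
  proof -
    have "v_prod C A = v_prod C B"
      using v_prod_commute[OF C A] v_prod_commute[OF C B] that(1) by simp
    then have "v_prod (polar C) (v_prod C A) = v_prod (polar C) (v_prod C B)" by (rule arg_cong)
    then show ?thesis unfolding v_prod_cancel_left[OF C A] v_prod_cancel_left[OF C B] .
  qed
  show ?thesis
    by (rule comm_monoid_cancelI[OF comm]) (unfold v_ideal_monoid_simps, rule cancel)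
qed

lemma divides_iff_supset:
  assumes "A \<in> v_ideals" "B \<in> v_ideals"
  shows "A divides\<^bsub>v_ideal_monoid\<^esub> B \<longleftrightarrow> B \<subseteq> A"
proof
  assume "A divides\<^bsub>v_ideal_monoid\<^esub> B"
  then obtain C where "C \<in> v_ideals" "B = v_prod A C"
    by (auto simp: factor_def v_ideal_monoid_simps)
  then show "B \<subseteq> A" using v_prod_subset_left assms(1) by simp
next
  assume "B \<subseteq> A"
  then obtain C where "C \<in> v_ideals" "B = v_prod A C"
    using subset_imp_factor[OF assms(2,1)] by auto
  then show "A divides\<^bsub>v_ideal_monoid\<^esub> B"
    by (auto simp: factor_def v_ideal_monoid_simps)
qed

lemma v_ideal_monoid_free: "free_abelian_monoid v_ideal_monoid maximal_v_ideals"
proof -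
  interpret V: comm_monoid_cancel v_ideal_monoid by (rule v_ideal_monoid_comm_cancel)
  have mult: "(\<otimes>\<^bsub>v_ideal_monoid\<^esub>) = v_prod" by (simp add: v_ideal_monoid_def)
  show ?thesis
  proof (rule V.free_abelian_monoid_primes)
    show "maximal_v_ideals \<subseteq> carrier v_ideal_monoid"
      using maximal_v_idealsD(1) by (auto simp: v_ideal_monoid_simps)
    show "\<exists>ps. set ps \<subseteq> maximal_v_ideals \<and> A = foldr (\<otimes>\<^bsub>v_ideal_monoid\<^esub>) ps \<one>\<^bsub>v_ideal_monoid\<^esub>"
      if "A \<in> carrier v_ideal_monoid" for A
      using v_ideal_factorization[of A] that unfolding mult by (simp add: v_ideal_monoid_simps)
    show "P divides\<^bsub>v_ideal_monoid\<^esub> A \<or> P divides\<^bsub>v_ideal_monoid\<^esub> B"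
      if "P \<in> maximal_v_ideals" "A \<in> carrier v_ideal_monoid" "B \<in> carrier v_ideal_monoid"
        "P divides\<^bsub>v_ideal_monoid\<^esub> A \<otimes>\<^bsub>v_ideal_monoid\<^esub> B" for P A B
      using that maximal_v_ideal_prime[of P A B] maximal_v_idealsD(1) v_prod_v_ideal
      by (auto simp: v_ideal_monoid_simps divides_iff_supset)
    show "P = Q" if "P \<in> maximal_v_ideals" "Q \<in> maximal_v_ideals" "P divides\<^bsub>v_ideal_monoid\<^esub> Q" for P Q
      using that maximal_v_ideals_incomparable[of Q P] maximal_v_idealsD(1)
      by (auto simp: divides_iff_supset)
    show "\<not> P divides\<^bsub>v_ideal_monoid\<^esub> \<one>\<^bsub>v_ideal_monoid\<^esub>" if "P \<in> maximal_v_ideals" for P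
      using maximal_v_idealsD(1,2)[OF that] v_idealsD(1) M_v_ideal
      by (auto simp: v_ideal_monoid_simps divides_iff_supset)
  qed
qed

text \<open>Among the \<open>v\<close>-closures of finite nonempty subsets of \<open>A\<close> there is a maximal one; it absorbs every
  further element of \<open>A\<close>.\<close>

lemma v_ideal_finitely_generated:
  assumes A: "A \<in> v_ideals"
  obtains X where "finite X" "X \<noteq> {}" "X \<subseteq> A" "A = v_closure X"
proof -
  note AV = v_idealsD[OF A]
  let ?S = "{v_closure X |X. finite X \<and> X \<noteq> {} \<and> X \<subseteq> A}"
  obtain c where c: "c \<in> A" using AV(4) by auto
  have S: "?S \<subseteq> v_ideals" using v_closure_v_ideal AV(1) by blast
  have "v_closure {c} \<in> ?S" using c by blast
  from v_ideals_maximal[OF S this]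
  obtain B where B: "B \<in> ?S" and max: "\<forall>C\<in>?S. B \<subseteq> C \<longrightarrow> C = B" ..
  from B obtain X where X: "finite X" "X \<noteq> {}" "X \<subseteq> A" "B = v_closure X" by blast
  have "a \<in> B" if a: "a \<in> A" for a
  proof -
    have "v_closure (insert a X) \<in> ?S" using X a by blast
    moreover have "B \<subseteq> v_closure (insert a X)" unfolding X(4) by (intro v_closure_mono) auto
    ultimately have "v_closure (insert a X) = B" using max by blast
    moreover have "insert a X \<subseteq> v_closure (insert a X)"
      using X a AV(2) by (intro subset_v_closure) auto
    ultimately show ?thesis by blast
  qed
  moreover have "B \<subseteq> A" unfolding X(4) by (rule v_closure_least[OF X(3) A])
  ultimately have "A = v_closure X" using X(4) by blast
  then show ?thesis using that X by blast
qed

end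

section \<open>Principal ideals as a divisor theory\<close>

context ore_monoid
begin

interpretation Q: group "quot_group H"
  by (rule group_quot_group)

text \<open>Conjugating by \<open>b \<in> H\<close> turns \<open>h\<close> into the \<open>k\<close> with \<open>b h = k b\<close>, and conjugating by \<open>a\<^sup>-\<^sup>1\<close> turns \<open>k\<close> into
  the \<open>l\<close> with \<open>k a = a l\<close>; both exist as \<open>H\<close> is normalizing, and every element of the quotient group is
  of the form \<open>a\<^sup>-\<^sup>1 b\<close>.\<close>

lemma normal_submonoid_emb_carrier:
  assumes "normalizing H"
  shows "normal_submonoid (quot_group H) (emb_carrier H)"
proof
  show "emb_carrier H \<subseteq> carrier (quot_group H)" by (rule emb_carrier_subset)
  show "\<one>\<^bsub>quot_group H\<^esub> \<in> emb_carrier H"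
    unfolding emb_carrier_def using quot_emb_one by (metis imageI one_closed)
  show "x \<otimes>\<^bsub>quot_group H\<^esub> y \<in> emb_carrier H" if "x \<in> emb_carrier H" "y \<in> emb_carrier H" for x y
    using that unfolding emb_carrier_def by (auto simp: quot_emb_mult[symmetric])
  have coset: "a <# carrier H = carrier H #> a" if "a \<in> carrier H" for a
    using assms that by (simp add: normalizing_def)
  show "g \<otimes>\<^bsub>quot_group H\<^esub> x \<otimes>\<^bsub>quot_group H\<^esub> inv\<^bsub>quot_group H\<^esub> g \<in> emb_carrier H"
    if x: "x \<in> emb_carrier H" and g: "g \<in> carrier (quot_group H)" for x g
  proof -
    obtain h where h: "h \<in> carrier H" "x = quot_emb H h" using x unfolding emb_carrier_def by auto
    obtain a b where ab: "a \<in> carrier H" "b \<in> carrier H"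
      "g = inv\<^bsub>quot_group H\<^esub> (quot_emb H a) \<otimes>\<^bsub>quot_group H\<^esub> quot_emb H b"
      using quot_group_left_fraction[OF g] by auto
    have "b \<otimes> h \<in> carrier H #> b" using coset[OF ab(2)] h(1) unfolding l_coset_def by auto
    then obtain k where k: "k \<in> carrier H" "b \<otimes> h = k \<otimes> b" unfolding r_coset_def by auto
    have "k \<otimes> a \<in> a <# carrier H" using coset[OF ab(1)] k(1) unfolding r_coset_def by auto
    then obtain l where l: "l \<in> carrier H" "k \<otimes> a = a \<otimes> l" unfolding l_coset_def by auto
    note closed = quot_emb_closed[OF ab(1)] quot_emb_closed[OF ab(2)] quot_emb_closed[OF h(1)]
      quot_emb_closed[OF k(1)] quot_emb_closed[OF l(1)]
    have bh: "quot_emb H b \<otimes>\<^bsub>quot_group H\<^esub> quot_emb H h = quot_emb H k \<otimes>\<^bsub>quot_group H\<^esub> quot_emb H b"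
      using k ab h by (metis quot_emb_mult)
    have ka: "quot_emb H k \<otimes>\<^bsub>quot_group H\<^esub> quot_emb H a = quot_emb H a \<otimes>\<^bsub>quot_group H\<^esub> quot_emb H l"
      using k ab l by (metis quot_emb_mult)
    have "g \<otimes>\<^bsub>quot_group H\<^esub> x = quot_emb H l \<otimes>\<^bsub>quot_group H\<^esub> g"
    proof -
      have "quot_emb H a \<otimes>\<^bsub>quot_group H\<^esub> (g \<otimes>\<^bsub>quot_group H\<^esub> x) = quot_emb H b \<otimes>\<^bsub>quot_group H\<^esub> quot_emb H h"
        using closed ab(3) h(2) by (simp add: Q.m_assoc[symmetric])
      also have "\<dots> = quot_emb H k \<otimes>\<^bsub>quot_group H\<^esub> (quot_emb H a \<otimes>\<^bsub>quot_group H\<^esub> g)"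
        unfolding bh using closed ab(3) by (simp add: Q.m_assoc[symmetric])
      also have "\<dots> = (quot_emb H k \<otimes>\<^bsub>quot_group H\<^esub> quot_emb H a) \<otimes>\<^bsub>quot_group H\<^esub> g"
        using closed g by (simp add: Q.m_assoc)
      also have "\<dots> = quot_emb H a \<otimes>\<^bsub>quot_group H\<^esub> (quot_emb H l \<otimes>\<^bsub>quot_group H\<^esub> g)"
        unfolding ka using closed g by (simp add: Q.m_assoc)
      finally show ?thesis
        by (rule Q.l_cancel) (use closed g h(2) in auto)
    qed
    then have "g \<otimes>\<^bsub>quot_group H\<^esub> x \<otimes>\<^bsub>quot_group H\<^esub> inv\<^bsub>quot_group H\<^esub> g = quot_emb H l"
      using closed g by (simp add: Q.m_assoc)
    then show ?thesis using l(1) unfolding emb_carrier_def by simp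
  qed
qed

end

locale normalizing_monoid = ore_monoid +
  assumes normalizing: "normalizing H"
begin

sublocale S: normal_submonoid "quot_group H" "emb_carrier H"
  by (rule normal_submonoid_emb_carrier[OF normalizing])

lemma rcolon_eq_polar: "rcolon H (emb_carrier H) A = S.polar A"
  unfolding rcolon_def r_coset_def S.polar_def by auto

lemma lcolon_eq_polar:
  assumes "A \<subseteq> carrier (quot_group H)"
  shows "lcolon H (emb_carrier H) A = S.polar A"
proof -
  have "x \<otimes>\<^bsub>quot_group H\<^esub> a \<in> emb_carrier H \<longleftrightarrow> a \<otimes>\<^bsub>quot_group H\<^esub> x \<in> emb_carrier H"
    if "x \<in> carrier (quot_group H)" "a \<in> A" for x a
    using S.mult_mem_swap[of x a] S.mult_mem_swap[of a x] that assms by blast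
  then show ?thesis unfolding lcolon_def l_coset_def S.polar_def by auto
qed

lemma colons_agree: "colons_agree H"
  unfolding colons_agree_def fractional_ideal_def
  using lcolon_eq_polar rcolon_eq_polar by auto

lemma v_lr_eq: "v_lr H A = S.v_closure A"
  by (simp add: v_lr_def S.v_closure_def rcolon_eq_polar lcolon_eq_polar S.polar_subset)

lemma v_rl_eq: "A \<subseteq> carrier (quot_group H) \<Longrightarrow> v_rl H A = S.v_closure A"
  by (simp add: v_rl_def S.v_closure_def rcolon_eq_polar lcolon_eq_polar)

lemma v_mult_eq: "v_mult H A B = S.v_prod A B"
  by (simp add: v_mult_def S.v_prod_def v_lr_eq)

lemma monoid_idealI:
  assumes "A \<subseteq> emb_carrier H"
    and l: "\<And>m a. m \<in> emb_carrier H \<Longrightarrow> a \<in> A \<Longrightarrow> m \<otimes>\<^bsub>quot_group H\<^esub> a \<in> A"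
    and r: "\<And>m a. m \<in> emb_carrier H \<Longrightarrow> a \<in> A \<Longrightarrow> a \<otimes>\<^bsub>quot_group H\<^esub> m \<in> A"
  shows "monoid_ideal H A"
proof -
  have A: "A \<subseteq> carrier (quot_group H)" using assms(1) emb_carrier_subset by auto
  have one: "\<one>\<^bsub>quot_group H\<^esub> <#\<^bsub>quot_group H\<^esub> A = A" "A #>\<^bsub>quot_group H\<^esub> \<one>\<^bsub>quot_group H\<^esub> = A"
    using A by (auto simp: l_coset_def r_coset_def subset_iff)
  \<comment> \<open>Both products contain the ideal since \<open>1\<close> lies in the monoid; the same \<open>1\<close> serves as the common
    denominator below.\<close>
  have "a \<in> emb_carrier H <#>\<^bsub>quot_group H\<^esub> A" "a \<in> A <#>\<^bsub>quot_group H\<^esub> emb_carrier H"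
    if "a \<in> A" for a
    using S.set_mult_memI[OF S.M_one that] S.set_mult_memI[OF that S.M_one] that A
    by (auto simp: subset_iff)
  then have "A \<subseteq> emb_carrier H <#>\<^bsub>quot_group H\<^esub> A" "A \<subseteq> A <#>\<^bsub>quot_group H\<^esub> emb_carrier H"
    by auto
  moreover have "emb_carrier H <#>\<^bsub>quot_group H\<^esub> A \<subseteq> A" "A <#>\<^bsub>quot_group H\<^esub> emb_carrier H \<subseteq> A"
    using l r unfolding set_mult_def by auto
  ultimately have "emb_carrier H <#>\<^bsub>quot_group H\<^esub> A = A" "A <#>\<^bsub>quot_group H\<^esub> emb_carrier H = A"
    by (simp_all add: subset_antisym)
  moreover have "\<exists>a\<in>emb_carrier H. a <#\<^bsub>quot_group H\<^esub> A \<subseteq> emb_carrier H"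
    using one(1) assms(1) by (intro bexI[OF _ S.M_one]) simp
  moreover have "\<exists>b\<in>emb_carrier H. A #>\<^bsub>quot_group H\<^esub> b \<subseteq> emb_carrier H"
    using one(2) assms(1) by (intro bexI[OF _ S.M_one]) simp
  ultimately show ?thesis
    unfolding monoid_ideal_def fractional_ideal_def using A assms(1) by (intro conjI)
qed

lemma v_ideals_eq: "S.v_ideals = divisorial_ideals H - {{}}"
proof
  show "S.v_ideals \<subseteq> divisorial_ideals H - {{}}"
  proof
    fix A assume A: "A \<in> S.v_ideals"
    note AV = S.v_idealsD[OF A]
    have "monoid_ideal H A" by (rule monoid_idealI[OF AV(1)]) (use S.v_ideal_mult[OF A] in auto)
    then show "A \<in> divisorial_ideals H - {{}}"
      using AV by (simp add: divisorial_ideals_def v_lr_eq v_rl_eq)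
  qed
  show "divisorial_ideals H - {{}} \<subseteq> S.v_ideals"
    by (auto simp: divisorial_ideals_def monoid_ideal_def S.v_ideals_def v_lr_eq)
qed

lemma krull_submonoid_emb_carrier:
  assumes "krull_monoid H"
  shows "krull_submonoid (quot_group H) (emb_carrier H)"
proof
  have cic: "lcolon H A A = emb_carrier H" "rcolon H A A = emb_carrier H"
    if "monoid_ideal H A" "A \<noteq> {}" for A
    using assms that unfolding krull_monoid_def completely_integrally_closed_def by auto
  fix A x
  assume A: "A \<subseteq> emb_carrier H" "A \<noteq> {}"
    "\<And>m a. m \<in> emb_carrier H \<Longrightarrow> a \<in> A \<Longrightarrow> m \<otimes>\<^bsub>quot_group H\<^esub> a \<in> A"
    "\<And>m a. m \<in> emb_carrier H \<Longrightarrow> a \<in> A \<Longrightarrow> a \<otimes>\<^bsub>quot_group H\<^esub> m \<in> A"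
    and x: "x \<in> carrier (quot_group H)"
  have ideal: "monoid_ideal H A" by (rule monoid_idealI[OF A(1,3,4)])
  show "x \<in> emb_carrier H" if "\<And>a. a \<in> A \<Longrightarrow> x \<otimes>\<^bsub>quot_group H\<^esub> a \<in> A"
    using cic(1)[OF ideal A(2)] that x unfolding lcolon_def l_coset_def by auto
  show "x \<in> emb_carrier H" if "\<And>a. a \<in> A \<Longrightarrow> a \<otimes>\<^bsub>quot_group H\<^esub> x \<in> A"
    using cic(2)[OF ideal A(2)] that x unfolding rcolon_def r_coset_def by auto
next
  fix A :: "nat \<Rightarrow> ('a \<times> 'a) set set"
  assume "\<And>n. A n \<in> S.v_ideals \<and> A n \<subseteq> A (Suc n)"
  then show "\<exists>N. \<forall>n\<ge>N. A n = A N"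
    using assms unfolding krull_monoid_def v_noetherian_def v_ideals_eq by blast
qed

end

locale normalizing_krull_monoid = normalizing_monoid +
  assumes krull: "krull_monoid H"
begin

sublocale S: krull_submonoid "quot_group H" "emb_carrier H"
  by (rule krull_submonoid_emb_carrier[OF krull])

lemma v_invertible_ideals_eq: "v_invertible_ideals H = S.v_ideal_monoid"
proof -
  have "{A \<in> divisorial_ideals H. v_invertible H A} = S.v_ideals"
  proof
    show "S.v_ideals \<subseteq> {A \<in> divisorial_ideals H. v_invertible H A}"
    proof
      fix A assume A: "A \<in> S.v_ideals"
      then have "v_invertible H A"
        using S.v_prod_polar_left S.v_prod_polar_right S.v_idealsD(2)
        by (simp add: v_invertible_def v_mult_eq ideal_inv_def lcolon_eq_polar)
      then show "A \<in> {A \<in> divisorial_ideals H. v_invertible H A}" using A v_ideals_eq by simp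
    qed
    \<comment> \<open>For empty \<open>A\<close>, divisoriality says that the closure of \<open>{}\<close> is empty, invertibility that it is all
      of \<open>H\<close>.\<close>
    have "A \<noteq> {}" if "A \<in> divisorial_ideals H" "v_invertible H A" for A
    proof
      assume "A = {}"
      then have "S.v_closure {} = {}" "S.v_closure {} = emb_carrier H"
        using that
        by (auto simp: divisorial_ideals_def v_lr_eq v_invertible_def v_mult_eq S.v_prod_def set_mult_def)
      then show False using S.M_one by simp
    qed
    then show "{A \<in> divisorial_ideals H. v_invertible H A} \<subseteq> S.v_ideals"
      using v_ideals_eq by auto
  qed
  moreover have "v_mult H = S.v_prod" by (intro ext) (rule v_mult_eq)
  ultimately show ?thesis by (simp add: v_invertible_ideals_def S.v_ideal_monoid_def)
qed

lemma principal_set_eq: "a \<in> carrier H \<Longrightarrow> principal_set H a = S.v_closure {quot_emb H a}"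
  by (simp add: principal_set_def S.v_closure_singleton quot_emb_closed)

lemma principal_set_v_ideal: "a \<in> carrier H \<Longrightarrow> principal_set H a \<in> S.v_ideals"
  unfolding principal_set_eq by (rule S.v_closure_v_ideal) (auto simp: emb_carrier_def)

lemma principal_set_subset_iff:
  assumes a: "a \<in> carrier H" and A: "A \<in> S.v_ideals"
  shows "principal_set H a \<subseteq> A \<longleftrightarrow> quot_emb H a \<in> A"
  using S.v_closure_least[OF _ A, of "{quot_emb H a}"] S.subset_v_closure[of "{quot_emb H a}"]
    quot_emb_closed[OF a] principal_set_eq[OF a] by auto

lemma principal_set_mult:
  assumes "a \<in> carrier H" "b \<in> carrier H"
  shows "principal_set H (a \<otimes> b) = S.v_prod (principal_set H a) (principal_set H b)"
proof -
  have "{quot_emb H a} \<subseteq> carrier (quot_group H)" "{quot_emb H b} \<subseteq> carrier (quot_group H)"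
    using assms quot_emb_closed by auto
  then have "S.v_prod (principal_set H a) (principal_set H b) = S.v_prod {quot_emb H a} {quot_emb H b}"
    using assms S.v_prod_v_closure_left S.v_prod_v_closure_right S.v_closure_subset
    by (simp add: principal_set_eq)
  also have "\<dots> = principal_set H (a \<otimes> b)"
    using assms by (simp add: S.v_prod_def set_mult_def principal_set_eq quot_emb_mult)
  finally show ?thesis by simp
qed

lemma principal_set_divides:
  assumes ab: "a \<in> carrier H" "b \<in> carrier H"
    and "principal_set H a divides\<^bsub>S.v_ideal_monoid\<^esub> principal_set H b"
  shows "a divides b"
proof -
  have "quot_emb H b \<in> principal_set H a"
    using assms S.divides_iff_supset principal_set_v_ideal principal_set_subset_iff by simp
  then obtain h where h: "h \<in> carrier H" "quot_emb H b = quot_emb H a \<otimes>\<^bsub>quot_group H\<^esub> quot_emb H h"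
    unfolding principal_set_def l_coset_def emb_carrier_def by auto
  then have "quot_emb H b = quot_emb H (a \<otimes> h)" using quot_emb_mult ab by simp
  then have "b = a \<otimes> h" using inj_onD[OF inj_on_quot_emb] ab h by simp
  then show ?thesis using h(1) by (auto simp: factor_def)
qed

lemma divisor_hom_principal_set: "divisor_hom H S.v_ideal_monoid (principal_set H)"
  unfolding divisor_hom_def
proof (intro conjI ballI impI)
  interpret V: comm_monoid_cancel S.v_ideal_monoid by (rule S.v_ideal_monoid_comm_cancel)
  show "principal_set H \<in> hom H S.v_ideal_monoid"
    by (auto simp: hom_def S.v_ideal_monoid_simps principal_set_v_ideal principal_set_mult)
  show "principal_set H \<one> = \<one>\<^bsub>S.v_ideal_monoid\<^esub>"
    using S.M_subset by (simp add: principal_set_def quot_emb_one S.v_ideal_monoid_simps S.lcos_mult_one)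
  fix a b assume ab: "a \<in> carrier H" "b \<in> carrier H"
  show "a divides b" if "principal_set H a divides\<^bsub>S.v_ideal_monoid\<^esub> principal_set H b"
    using that by (rule principal_set_divides[OF ab])
  show "right_divides H a b" if right: "right_divides S.v_ideal_monoid (principal_set H a) (principal_set H b)"
  proof -
    have "principal_set H a \<in> carrier S.v_ideal_monoid"
      using principal_set_v_ideal ab by (simp add: S.v_ideal_monoid_simps)
    then have "principal_set H a divides\<^bsub>S.v_ideal_monoid\<^esub> principal_set H b"
      using right V.m_comm unfolding right_divides_def factor_def by metis
    then have "a divides b" by (rule principal_set_divides[OF ab])
    then have "b \<in> a <# carrier H" unfolding factor_def l_coset_def by auto
    then have "b \<in> carrier H #> a" using normalizing ab unfolding normalizing_def by simp
    then show ?thesis unfolding right_divides_def r_coset_def by auto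
  qed
qed

text \<open>A \<open>v\<close>-ideal divides all \<open>x H\<close> with \<open>x \<in> X\<close> exactly if it contains \<open>X\<close>, so the \<open>v\<close>-ideal generated by
  \<open>X\<close> is the greatest common divisor of these principal ideals.\<close>

lemma v_ideal_gcd_principal_sets:
  assumes A: "A \<in> S.v_ideals"
  shows "\<exists>X. X \<subseteq> carrier H \<and> finite X \<and> X \<noteq> {} \<and> is_gcd S.v_ideal_monoid A (principal_set H ` X)"
proof -
  obtain Y where Y: "finite Y" "Y \<noteq> {}" "Y \<subseteq> A" "A = S.v_closure Y"
    using S.v_ideal_finitely_generated[OF A] .
  have "Y \<subseteq> quot_emb H ` carrier H"
    using Y(3) S.v_idealsD(1)[OF A] unfolding emb_carrier_def by auto
  then obtain X where X: "X \<subseteq> carrier H" "finite X" "Y = quot_emb H ` X"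
    using finite_subset_image[OF Y(1)] by metis
  have common: "(\<forall>y\<in>principal_set H ` X. B divides\<^bsub>S.v_ideal_monoid\<^esub> y) \<longleftrightarrow> Y \<subseteq> B"
    if B: "B \<in> S.v_ideals" for B
  proof -
    have "B divides\<^bsub>S.v_ideal_monoid\<^esub> principal_set H x \<longleftrightarrow> quot_emb H x \<in> B" if "x \<in> X" for x
    proof -
      have "x \<in> carrier H" using that X(1) by auto
      then show ?thesis
        using S.divides_iff_supset[OF B principal_set_v_ideal] principal_set_subset_iff[OF _ B] by simp
    qed
    then show ?thesis using X(3) by auto
  qed
  have "is_gcd S.v_ideal_monoid A (principal_set H ` X)"
    unfolding is_gcd_def S.v_ideal_monoid_simps
    using common A Y(3) S.v_closure_least[of Y] Y(4) by (auto simp: S.divides_iff_supset)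
  then show ?thesis using X Y(2) by blast
qed

lemma divisor_theory_principal_set: "divisor_theory H (v_invertible_ideals H) (principal_set H)"
  unfolding divisor_theory_def v_invertible_ideals_eq
  using divisor_hom_principal_set S.v_ideal_monoid_free v_ideal_gcd_principal_sets
    S.maximal_v_idealsD(1) by blast

end

section \<open>The equivalence\<close>

theorem theorem4p13:
  fixes H :: "('a, 'm) monoid_scheme"
  assumes "ore_monoid H"
  shows
    "((colons_agree H \<and>
       (\<forall>a\<in>carrier H. principal_set H a \<in> carrier (v_invertible_ideals H)) \<and>
       divisor_theory H (v_invertible_ideals H) (principal_set H))
        \<longleftrightarrow> normalizing H \<and> krull_monoid H) \<and>
     ((\<exists>(D :: ('a \<times> 'a) set set monoid) \<phi>. divisor_theory H D \<phi>)
        \<longleftrightarrow> normalizing H \<and> krull_monoid H) \<and>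
     ((\<exists>(D :: ('a \<times> 'a) set set monoid) P \<phi>. free_abelian_monoid D P \<and> divisor_hom H D \<phi>)
        \<longleftrightarrow> normalizing H \<and> krull_monoid H) \<and>
     ((\<exists>(D :: 'd monoid) \<phi>. divisor_theory H D \<phi>)
        \<longrightarrow> normalizing H \<and> krull_monoid H) \<and>
     ((\<exists>(D :: 'd monoid) P \<phi>. free_abelian_monoid D P \<and> divisor_hom H D \<phi>)
        \<longrightarrow> normalizing H \<and> krull_monoid H)"
proof -
  interpret ore_monoid H by (rule assms)
  have krull_imp: "colons_agree H \<and>
      (\<forall>a\<in>carrier H. principal_set H a \<in> carrier (v_invertible_ideals H)) \<and>
      divisor_theory H (v_invertible_ideals H) (principal_set H)"
    if "normalizing H \<and> krull_monoid H"
  proof -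
    interpret K: normalizing_krull_monoid H by unfold_locales (use that in auto)
    show ?thesis
      using K.colons_agree K.divisor_theory_principal_set K.principal_set_v_ideal
      by (simp add: K.v_invertible_ideals_eq K.S.v_ideal_monoid_simps)
  qed
  let ?N = "normalizing H \<and> krull_monoid H"
  have theory_imp: "(\<exists>(D :: 'd monoid) \<phi>. divisor_theory H D \<phi>) \<longrightarrow> ?N"
    "(\<exists>(D :: ('a \<times> 'a) set set monoid) \<phi>. divisor_theory H D \<phi>) \<longrightarrow> ?N"
    by (intro impI, elim exE, erule normalizing_krull_divisor_theory)+
  have hom_imp: "(\<exists>(D :: 'd monoid) P \<phi>. free_abelian_monoid D P \<and> divisor_hom H D \<phi>) \<longrightarrow> ?N"
    "(\<exists>(D :: ('a \<times> 'a) set set monoid) P \<phi>. free_abelian_monoid D P \<and> divisor_hom H D \<phi>) \<longrightarrow> ?N"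
    by (intro impI, elim exE conjE, erule (1) normalizing_krull_divisor_hom)+
  have ideals_iff: "(colons_agree H \<and>
      (\<forall>a\<in>carrier H. principal_set H a \<in> carrier (v_invertible_ideals H)) \<and>
      divisor_theory H (v_invertible_ideals H) (principal_set H)) \<longleftrightarrow> ?N"
    using krull_imp normalizing_krull_divisor_theory by blast
  have theory_iff: "(\<exists>(D :: ('a \<times> 'a) set set monoid) \<phi>. divisor_theory H D \<phi>) \<longleftrightarrow> ?N"
  proof
    assume ?N
    then have "divisor_theory H (v_invertible_ideals H) (principal_set H)" using krull_imp by simp
    then show "\<exists>(D :: ('a \<times> 'a) set set monoid) \<phi>. divisor_theory H D \<phi>" by (intro exI)
  qed (rule theory_imp(2)[rule_format])
  have hom_iff: "(\<exists>(D :: ('a \<times> 'a) set set monoid) P \<phi>. free_abelian_monoid D P \<and> divisor_hom H D \<phi>) \<longleftrightarrow> ?N"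
  proof
    assume ?N
    then have "divisor_theory H (v_invertible_ideals H) (principal_set H)" using krull_imp by simp
    then show "\<exists>(D :: ('a \<times> 'a) set set monoid) P \<phi>. free_abelian_monoid D P \<and> divisor_hom H D \<phi>"
      unfolding divisor_theory_def by blast
  qed (rule hom_imp(2)[rule_format])
  show ?thesis
    by (intro conjI ideals_iff theory_iff hom_iff theory_imp(1) hom_imp(1))
qed

end
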